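(* Let $\mathcal{D}$ be the free dicartesian category generated by a set $\mathcal{L}$ of propositional letters, and let $G$ be the functor from $\mathcal{D}$ to the category $\mathcal{G}$ of relations on finite ordinals (both as defined in the context). If $f,g:A\rightarrow B$ are terms of $\mathcal{D}$ such that $G(f)=G(g)$ and either $A$ is $\mathrm{O}$-normal or $B$ is $\mathrm{I}$-normal, then $f=g$ in $\mathcal{D}$.
   Context: Formulae. Let $\mathcal{L}$ be a set, whose members are called propositional letters. The set $\mathcal{P}$ of formulae is generated from $\mathcal{L}$ and the constants $\mathrm{I}$ and $\mathrm{O}$ with the binary connectives $\times$ and $+$. Terms of $\mathcal{D}$. Each term has a type $(A,B)$, a pair of formulae of $\mathcal{P}$; we write $f:A\rightarrow B$. The atomic terms are, for all formulae $A,B$: $\mathbf{1}_A:A\rightarrow A$; $k_A:A\rightarrow\mathrm{I}$; $l_A:\mathrm{O}\rightarrow A$; $k^1_{A,B}:A\times B\rightarrow A$; $k^2_{A,B}:A\times B\rightarrow B$; $w_A:A\rightarrow A\times A$; $l^1_{A,B}:A\rightarrow A+B$; $l^2_{A,B}:B\rightarrow A+B$; $m_A:A+A\rightarrow A$. Other terms are generated by: from $f:A\rightarrow B$ and $g:B\rightarrow C$ form $g\circ f:A\rightarrow C$; from $f:A\rightarrow B$ and $g:C\rightarrow D$ form $f\times g:A\times C\rightarrow B\times D$ and $f+g:A+C\rightarrow B+D$. The category $\mathcal{D}$ (free dicartesian category generated by $\mathcal{L}$). Its objects are the formulae of $\mathcal{P}$ and its arrows are equivalence classes of terms under the smallest type-respecting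 equivalence relation that is a congruence for $\circ,\times,+$ and contains all (well-typed) instances of the following equations, for $i\in\{1,2\}$; "$f=g$ in $\mathcal{D}$" means that the terms $f,g$ are equivalent. - $\mathbf{1}_B\circ f=f\circ\mathbf{1}_A=f$ for $f:A\rightarrow B$; $h\circ(g\circ f)=(h\circ g)\circ f$. - $\mathbf{1}_A\times\mathbf{1}_B=\mathbf{1}_{A\times B}$; $(g_1\circ g_2)\times(f_1\circ f_2)=(g_1\times f_1)\circ(g_2\times f_2)$; $k^i_{B_1,B_2}\circ(f_1\times f_2)=f_i\circ k^i_{A_1,A_2}$ for $f_j:A_j\rightarrow B_j$; $w_B\circ f=(f\times f)\circ w_A$ for $f:A\rightarrow B$; $k^i_{A,A}\circ w_A=\mathbf{1}_A$; $(k^1_{A,B}\times k^2_{A,B})\circ w_{A\times B}=\mathbf{1}_{A\times B}$; $f=k_A$ for every $f:A\rightarrow\mathrm{I}$; $k^1_{\mathrm{O},\mathrm{O}}=k^2_{\mathrm{O},\mathrm{O}}$. - $\mathbf{1}_A+\mathbf{1}_B=\mathbf{1}_{A+B}$; $(g_1\circ g_2)+(f_1\circ f_2)=(g_1+f_1)\circ(g_2+f_2)$; $(f_1+f_2)\circ l^i_{A_1,A_2}=l^i_{B_1,B_2}\circ f_i$ for $f_j:A_j\rightarrow B_j$; $f\circ m_A=m_B\circ(f+f)$ for $f:A\rightarrow B$; $m_A\circ l^i_{A,A}=\mathbf{1}_A$; $m_{A+B}\circ(l^1_{A,B}+l^2_{A,B})=\mathbf{1}_{A+B}$; $f=l_A$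 for every $f:\mathrm{O}\rightarrow A$; $l^1_{\mathrm{I},\mathrm{I}}=l^2_{\mathrm{I},\mathrm{I}}$. The category $\mathcal{G}$ and the functor $G$. The objects of $\mathcal{G}$ are finite ordinals $n=\{0,\dots,n-1\}$; an arrow $n\rightarrow m$ is a binary relation, i.e. a subset of $n\times m$; identities are identity relations and composition is composition of relations. For a formula $A$ let $|A|$ be the number of occurrences of propositional letters in $A$. Put $G(A)=|A|$, and on terms: $G(\mathbf{1}_A)=\{(x,x):x\in|A|\}$; $G(k^1_{A,B})=\{(x,x):x\in|A|\}$; $G(k^2_{A,B})=\{(x+|A|,x):x\in|B|\}$; $G(w_A)=\{(x,x):x\in|A|\}\cup\{(x,x+|A|):x\in|A|\}$; $G(k_A)=\emptyset$; $G(l^1_{A,B})=\{(x,x):x\in|A|\}$; $G(l^2_{A,B})=\{(x,x+|A|):x\in|B|\}$; $G(m_A)=\{(x,x):x\in|A|\}\cup\{(x+|A|,x):x\in|A|\}$; $G(l_A)=\emptyset$; $G(g\circ f)=G(g)\circ G(f)$; and for $f:A\rightarrow B$, $g:C\rightarrow D$, $G(f\times g)=G(f+g)=G(f)\cup\{(x+|A|,y+|B|):(x,y)\in G(g)\}$. This is compatible with equality in $\mathcal{D}$ and gives a functor from $\mathcal{D}$ to $\mathcal{G}$. Normality. A formula $C$ of $\mathcal{P}$ is a contradiction when there is in $\mathcal{D}$ an arrow of type $C\rightarrow\mathrm{O}$, and a tautology when there is in $\mathcal{D}$ an arrow of type $\mathrm{I}\rightarrow C$. A formula of $\mathcal{P}$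 is $\mathrm{O}$-normal when for every subformula $D\times C$ or $C\times D$ of it with $C$ a contradiction, there is no occurrence of $+$ in $D$. A formula of $\mathcal{P}$ is $\mathrm{I}$-normal when for every subformula $D+C$ or $C+D$ of it with $C$ a tautology, there is no occurrence of $\times$ in $D$. *)

theory Defs
  imports Main
begin

datatype 'l fm =
    Letter 'l
  | FI
  | FO
  | Times "'l fm" "'l fm"  (infixr "\<^bold>\<times>" 70)
  | Plus "'l fm" "'l fm"  (infixr "\<^bold>+" 65)

text \<open>The set of letters is an arbitrary (possibly empty) set \<open>\<L>\<close> of elements of the type
  \<open>'l\<close>, so formulae, terms and the equality of terms are all relative to \<open>\<L>\<close>.\<close>

inductive_set formulae :: "'l set \<Rightarrow> 'l fm set" for \<L> :: "'l set" where
  "p \<in> \<L> \<Longrightarrow> Letter p \<in> formulae \<L>"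
| "FI \<in> formulae \<L>"
| "FO \<in> formulae \<L>"
| "\<lbrakk>A \<in> formulae \<L>; B \<in> formulae \<L>\<rbrakk> \<Longrightarrow> A \<^bold>\<times> B \<in> formulae \<L>"
| "\<lbrakk>A \<in> formulae \<L>; B \<in> formulae \<L>\<rbrakk> \<Longrightarrow> A \<^bold>+ B \<in> formulae \<L>"

text \<open>Raw terms; the terms of the category are those satisfying \<open>typed\<close> below. The composite
  \<open>g \<cdot> f\<close> is in applicative order.\<close>

datatype 'l tm =
    IdT "'l fm"
  | KT "'l fm"
  | LT "'l fm"
  | K1 "'l fm" "'l fm"
  | K2 "'l fm" "'l fm"
  | WT "'l fm"
  | L1 "'l fm" "'l fm"
  | L2 "'l fm" "'l fm"
  | MT "'l fm"
  | Comp "'l tm" "'l tm"  (infixr "\<cdot>" 60)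
  | TimesT "'l tm" "'l tm"  (infixr "\<otimes>" 70)
  | PlusT "'l tm" "'l tm"  (infixr "\<oplus>" 65)

inductive typed :: "'l set \<Rightarrow> 'l tm \<Rightarrow> 'l fm \<Rightarrow> 'l fm \<Rightarrow> bool" for \<L> :: "'l set" where
  typed_Id: "A \<in> formulae \<L> \<Longrightarrow> typed \<L> (IdT A) A A"
| typed_K: "A \<in> formulae \<L> \<Longrightarrow> typed \<L> (KT A) A FI"
| typed_L: "A \<in> formulae \<L> \<Longrightarrow> typed \<L> (LT A) FO A"
| typed_K1: "\<lbrakk>A \<in> formulae \<L>; B \<in> formulae \<L>\<rbrakk> \<Longrightarrow> typed \<L> (K1 A B) (A \<^bold>\<times> B) A"
| typed_K2: "\<lbrakk>A \<in> formulae \<L>; B \<in> formulae \<L>\<rbrakk> \<Longrightarrow> typed \<L> (K2 A B) (A \<^bold>\<times> B) B"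
| typed_W: "A \<in> formulae \<L> \<Longrightarrow> typed \<L> (WT A) A (A \<^bold>\<times> A)"
| typed_L1: "\<lbrakk>A \<in> formulae \<L>; B \<in> formulae \<L>\<rbrakk> \<Longrightarrow> typed \<L> (L1 A B) A (A \<^bold>+ B)"
| typed_L2: "\<lbrakk>A \<in> formulae \<L>; B \<in> formulae \<L>\<rbrakk> \<Longrightarrow> typed \<L> (L2 A B) B (A \<^bold>+ B)"
| typed_M: "A \<in> formulae \<L> \<Longrightarrow> typed \<L> (MT A) (A \<^bold>+ A) A"
| typed_Comp: "\<lbrakk>typed \<L> f A B; typed \<L> g B C\<rbrakk> \<Longrightarrow> typed \<L> (g \<cdot> f) A C"
| typed_Times: "\<lbrakk>typed \<L> f A B; typed \<L> g C D\<rbrakk> \<Longrightarrow> typed \<L> (f \<otimes> g) (A \<^bold>\<times> C) (B \<^bold>\<times> D)"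
| typed_Plus: "\<lbrakk>typed \<L> f A B; typed \<L> g C D\<rbrakk> \<Longrightarrow> typed \<L> (f \<oplus> g) (A \<^bold>+ C) (B \<^bold>+ D)"

text \<open>\<open>eqD \<L> A B f g\<close> says that \<open>f\<close> and \<open>g\<close> are terms of type \<open>(A, B)\<close> over \<open>\<L>\<close> that are
  equal in the free dicartesian category generated by \<open>\<L>\<close>.\<close>

inductive eqD :: "'l set \<Rightarrow> 'l fm \<Rightarrow> 'l fm \<Rightarrow> 'l tm \<Rightarrow> 'l tm \<Rightarrow> bool" for \<L> :: "'l set" where
  eqD_refl: "typed \<L> f A B \<Longrightarrow> eqD \<L> A B f f"
| eqD_sym: "eqD \<L> A B f g \<Longrightarrow> eqD \<L> A B g f"
| eqD_trans: "\<lbrakk>eqD \<L> A B f g; eqD \<L> A B g h\<rbrakk> \<Longrightarrow> eqD \<L> A B f h"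
| cong_Comp: "\<lbrakk>eqD \<L> A B f f'; eqD \<L> B C g g'\<rbrakk> \<Longrightarrow> eqD \<L> A C (g \<cdot> f) (g' \<cdot> f')"
| cong_Times: "\<lbrakk>eqD \<L> A B f f'; eqD \<L> C D g g'\<rbrakk>
    \<Longrightarrow> eqD \<L> (A \<^bold>\<times> C) (B \<^bold>\<times> D) (f \<otimes> g) (f' \<otimes> g')"
| cong_Plus: "\<lbrakk>eqD \<L> A B f f'; eqD \<L> C D g g'\<rbrakk>
    \<Longrightarrow> eqD \<L> (A \<^bold>+ C) (B \<^bold>+ D) (f \<oplus> g) (f' \<oplus> g')"
| cat_left: "typed \<L> f A B \<Longrightarrow> eqD \<L> A B (IdT B \<cdot> f) f"
| cat_right: "typed \<L> f A B \<Longrightarrow> eqD \<L> A B (f \<cdot> IdT A) f"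
| cat_assoc: "\<lbrakk>typed \<L> f A B; typed \<L> g B C; typed \<L> h C D\<rbrakk>
    \<Longrightarrow> eqD \<L> A D (h \<cdot> (g \<cdot> f)) ((h \<cdot> g) \<cdot> f)"
| times_Id: "\<lbrakk>A \<in> formulae \<L>; B \<in> formulae \<L>\<rbrakk>
    \<Longrightarrow> eqD \<L> (A \<^bold>\<times> B) (A \<^bold>\<times> B) (IdT A \<otimes> IdT B) (IdT (A \<^bold>\<times> B))"
| times_Comp: "\<lbrakk>typed \<L> g\<^sub>2 A B; typed \<L> g\<^sub>1 B C; typed \<L> f\<^sub>2 A' B'; typed \<L> f\<^sub>1 B' C'\<rbrakk>
    \<Longrightarrow> eqD \<L> (A \<^bold>\<times> A') (C \<^bold>\<times> C') ((g\<^sub>1 \<cdot> g\<^sub>2) \<otimes> (f\<^sub>1 \<cdot> f\<^sub>2)) ((g\<^sub>1 \<otimes> f\<^sub>1) \<cdot> (g\<^sub>2 \<otimes> f\<^sub>2))"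
| K1_nat: "\<lbrakk>typed \<L> f\<^sub>1 A\<^sub>1 B\<^sub>1; typed \<L> f\<^sub>2 A\<^sub>2 B\<^sub>2\<rbrakk>
    \<Longrightarrow> eqD \<L> (A\<^sub>1 \<^bold>\<times> A\<^sub>2) B\<^sub>1 (K1 B\<^sub>1 B\<^sub>2 \<cdot> (f\<^sub>1 \<otimes> f\<^sub>2)) (f\<^sub>1 \<cdot> K1 A\<^sub>1 A\<^sub>2)"
| K2_nat: "\<lbrakk>typed \<L> f\<^sub>1 A\<^sub>1 B\<^sub>1; typed \<L> f\<^sub>2 A\<^sub>2 B\<^sub>2\<rbrakk>
    \<Longrightarrow> eqD \<L> (A\<^sub>1 \<^bold>\<times> A\<^sub>2) B\<^sub>2 (K2 B\<^sub>1 B\<^sub>2 \<cdot> (f\<^sub>1 \<otimes> f\<^sub>2)) (f\<^sub>2 \<cdot> K2 A\<^sub>1 A\<^sub>2)"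
| W_nat: "typed \<L> f A B \<Longrightarrow> eqD \<L> A (B \<^bold>\<times> B) (WT B \<cdot> f) ((f \<otimes> f) \<cdot> WT A)"
| K1_W: "A \<in> formulae \<L> \<Longrightarrow> eqD \<L> A A (K1 A A \<cdot> WT A) (IdT A)"
| K2_W: "A \<in> formulae \<L> \<Longrightarrow> eqD \<L> A A (K2 A A \<cdot> WT A) (IdT A)"
| K1_K2_W: "\<lbrakk>A \<in> formulae \<L>; B \<in> formulae \<L>\<rbrakk>
    \<Longrightarrow> eqD \<L> (A \<^bold>\<times> B) (A \<^bold>\<times> B) ((K1 A B \<otimes> K2 A B) \<cdot> WT (A \<^bold>\<times> B)) (IdT (A \<^bold>\<times> B))"
| K_unique: "typed \<L> f A FI \<Longrightarrow> eqD \<L> A FI f (KT A)"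
| K1_K2_FO: "eqD \<L> (FO \<^bold>\<times> FO) FO (K1 FO FO) (K2 FO FO)"
| plus_Id: "\<lbrakk>A \<in> formulae \<L>; B \<in> formulae \<L>\<rbrakk>
    \<Longrightarrow> eqD \<L> (A \<^bold>+ B) (A \<^bold>+ B) (IdT A \<oplus> IdT B) (IdT (A \<^bold>+ B))"
| plus_Comp: "\<lbrakk>typed \<L> g\<^sub>2 A B; typed \<L> g\<^sub>1 B C; typed \<L> f\<^sub>2 A' B'; typed \<L> f\<^sub>1 B' C'\<rbrakk>
    \<Longrightarrow> eqD \<L> (A \<^bold>+ A') (C \<^bold>+ C') ((g\<^sub>1 \<cdot> g\<^sub>2) \<oplus> (f\<^sub>1 \<cdot> f\<^sub>2)) ((g\<^sub>1 \<oplus> f\<^sub>1) \<cdot> (g\<^sub>2 \<oplus> f\<^sub>2))"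
| L1_nat: "\<lbrakk>typed \<L> f\<^sub>1 A\<^sub>1 B\<^sub>1; typed \<L> f\<^sub>2 A\<^sub>2 B\<^sub>2\<rbrakk>
    \<Longrightarrow> eqD \<L> A\<^sub>1 (B\<^sub>1 \<^bold>+ B\<^sub>2) ((f\<^sub>1 \<oplus> f\<^sub>2) \<cdot> L1 A\<^sub>1 A\<^sub>2) (L1 B\<^sub>1 B\<^sub>2 \<cdot> f\<^sub>1)"
| L2_nat: "\<lbrakk>typed \<L> f\<^sub>1 A\<^sub>1 B\<^sub>1; typed \<L> f\<^sub>2 A\<^sub>2 B\<^sub>2\<rbrakk>
    \<Longrightarrow> eqD \<L> A\<^sub>2 (B\<^sub>1 \<^bold>+ B\<^sub>2) ((f\<^sub>1 \<oplus> f\<^sub>2) \<cdot> L2 A\<^sub>1 A\<^sub>2) (L2 B\<^sub>1 B\<^sub>2 \<cdot> f\<^sub>2)"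
| M_nat: "typed \<L> f A B \<Longrightarrow> eqD \<L> (A \<^bold>+ A) B (f \<cdot> MT A) (MT B \<cdot> (f \<oplus> f))"
| M_L1: "A \<in> formulae \<L> \<Longrightarrow> eqD \<L> A A (MT A \<cdot> L1 A A) (IdT A)"
| M_L2: "A \<in> formulae \<L> \<Longrightarrow> eqD \<L> A A (MT A \<cdot> L2 A A) (IdT A)"
| M_L1_L2: "\<lbrakk>A \<in> formulae \<L>; B \<in> formulae \<L>\<rbrakk>
    \<Longrightarrow> eqD \<L> (A \<^bold>+ B) (A \<^bold>+ B) (MT (A \<^bold>+ B) \<cdot> (L1 A B \<oplus> L2 A B)) (IdT (A \<^bold>+ B))"
| L_unique: "typed \<L> f FO A \<Longrightarrow> eqD \<L> FO A f (LT A)"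
| L1_L2_FI: "eqD \<L> FI (FI \<^bold>+ FI) (L1 FI FI) (L2 FI FI)"

primrec letter_count :: "'l fm \<Rightarrow> nat" where
  "letter_count (Letter p) = 1"
| "letter_count FI = 0"
| "letter_count FO = 0"
| "letter_count (A \<^bold>\<times> B) = letter_count A + letter_count B"
| "letter_count (A \<^bold>+ B) = letter_count A + letter_count B"

primrec src :: "'l tm \<Rightarrow> 'l fm" where
  "src (IdT A) = A"
| "src (KT A) = A"
| "src (LT A) = FO"
| "src (K1 A B) = A \<^bold>\<times> B"
| "src (K2 A B) = A \<^bold>\<times> B"
| "src (WT A) = A"
| "src (L1 A B) = A"
| "src (L2 A B) = B"
| "src (MT A) = A \<^bold>+ A"
| "src (g \<cdot> f) = src f"
| "src (f \<otimes> g) = src f \<^bold>\<times> src g"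
| "src (f \<oplus> g) = src f \<^bold>+ src g"

primrec tgt :: "'l tm \<Rightarrow> 'l fm" where
  "tgt (IdT A) = A"
| "tgt (KT A) = FI"
| "tgt (LT A) = A"
| "tgt (K1 A B) = A"
| "tgt (K2 A B) = B"
| "tgt (WT A) = A \<^bold>\<times> A"
| "tgt (L1 A B) = A \<^bold>+ B"
| "tgt (L2 A B) = A \<^bold>+ B"
| "tgt (MT A) = A"
| "tgt (g \<cdot> f) = tgt g"
| "tgt (f \<otimes> g) = tgt f \<^bold>\<times> tgt g"
| "tgt (f \<oplus> g) = tgt f \<^bold>+ tgt g"

lemma typed_src_tgt: "typed \<L> f A B \<Longrightarrow> src f = A \<and> tgt f = B"
  by (induction rule: typed.induct) auto

lemma typed_formulae: "typed \<L> f A B \<Longrightarrow> A \<in> formulae \<L> \<and> B \<in> formulae \<L>"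
  by (induction rule: typed.induct) (auto intro: formulae.intros)

lemma eqD_typed: "eqD \<L> A B f g \<Longrightarrow> typed \<L> f A B \<and> typed \<L> g A B"
  by (induction rule: eqD.induct)
    (auto intro!: formulae.intros intro: typed.intros dest: typed_formulae)

text \<open>The arrows of the category of relations are relations between initial segments of the
  naturals. The library composition \<open>r O s\<close> is in diagrammatic order.\<close>

definition juxtapose :: "nat \<Rightarrow> nat \<Rightarrow> (nat \<times> nat) set \<Rightarrow> (nat \<times> nat) set \<Rightarrow> (nat \<times> nat) set" where
  "juxtapose a b r s = r \<union> {(x + a, y + b) | x y. (x, y) \<in> s}"

primrec G :: "'l tm \<Rightarrow> (nat \<times> nat) set" where
  "G (IdT A) = {(x, x) | x. x < letter_count A}"
| "G (KT A) = {}"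
| "G (LT A) = {}"
| "G (K1 A B) = {(x, x) | x. x < letter_count A}"
| "G (K2 A B) = {(x + letter_count A, x) | x. x < letter_count B}"
| "G (WT A) = {(x, x) | x. x < letter_count A} \<union> {(x, x + letter_count A) | x. x < letter_count A}"
| "G (L1 A B) = {(x, x) | x. x < letter_count A}"
| "G (L2 A B) = {(x, x + letter_count A) | x. x < letter_count B}"
| "G (MT A) = {(x, x) | x. x < letter_count A} \<union> {(x + letter_count A, x) | x. x < letter_count A}"
| "G (g \<cdot> f) = G f O G g"
| "G (f \<otimes> g) = juxtapose (letter_count (src f)) (letter_count (tgt f)) (G f) (G g)"
| "G (f \<oplus> g) = juxtapose (letter_count (src f)) (letter_count (tgt f)) (G f) (G g)"

definition contradiction :: "'l set \<Rightarrow> 'l fm \<Rightarrow> bool" where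
  "contradiction \<L> C \<longleftrightarrow> (\<exists>f. typed \<L> f C FO)"

definition tautology :: "'l set \<Rightarrow> 'l fm \<Rightarrow> bool" where
  "tautology \<L> C \<longleftrightarrow> (\<exists>f. typed \<L> f FI C)"

primrec subformulae :: "'l fm \<Rightarrow> 'l fm set" where
  "subformulae (Letter p) = {Letter p}"
| "subformulae FI = {FI}"
| "subformulae FO = {FO}"
| "subformulae (A \<^bold>\<times> B) = insert (A \<^bold>\<times> B) (subformulae A \<union> subformulae B)"
| "subformulae (A \<^bold>+ B) = insert (A \<^bold>+ B) (subformulae A \<union> subformulae B)"

definition times_occurs :: "'l fm \<Rightarrow> bool" where
  "times_occurs D \<longleftrightarrow> (\<exists>A B. A \<^bold>\<times> B \<in> subformulae D)"

definition plus_occurs :: "'l fm \<Rightarrow> bool" where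
  "plus_occurs D \<longleftrightarrow> (\<exists>A B. A \<^bold>+ B \<in> subformulae D)"

definition O_normal :: "'l set \<Rightarrow> 'l fm \<Rightarrow> bool" where
  "O_normal \<L> A \<longleftrightarrow>
    (\<forall>C D. (D \<^bold>\<times> C \<in> subformulae A \<or> C \<^bold>\<times> D \<in> subformulae A) \<and> contradiction \<L> C
      \<longrightarrow> \<not> plus_occurs D)"

definition I_normal :: "'l set \<Rightarrow> 'l fm \<Rightarrow> bool" where
  "I_normal \<L> A \<longleftrightarrow>
    (\<forall>C D. (D \<^bold>+ C \<in> subformulae A \<or> C \<^bold>+ D \<in> subformulae A) \<and> tautology \<L> C
      \<longrightarrow> \<not> times_occurs D)"

end

theory Submission
  imports Defs
begin

text \<open>Every term equals a cut-free one. Cut elimination gives two facts. First, an arrow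
  \<open>f : A \<rightarrow> B\<close> with \<open>G f = {}\<close> exists only if \<open>A\<close> is a contradiction or \<open>B\<close> a tautology,
  and it then factors through \<open>O\<close> or \<open>I\<close> accordingly, so it is determined by its type.
  Second, an arrow \<open>A\<^sub>1 \<times> A\<^sub>2 \<rightarrow> C\<close> whose relation involves only letters of \<open>A\<^sub>1\<close> factors through the
  projection to \<open>A\<^sub>1\<close>, except that an empty component produced from a contradiction in \<open>A\<^sub>2\<close>
  may get in the way, which needs \<open>\<times>\<close> in \<open>C\<close>; and dually for injections. Equality of two
  arrows with the same nonempty relation is then proved by induction on the type. The only case
  in which the last steps of the two cut-free terms do not match is that of
  \<open>h \<cdot> k\<^sup>i\<close> against \<open>l\<^sup>j \<cdot> k\<close>; normality of either end lets one of \<open>h\<close>, \<open>k\<close> be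
  factored further, so that the induction hypothesis applies.\<close>

subsection \<open>Duality and soundness of \<open>G\<close>\<close>

text \<open>Formal duality exchanges products with sums and \<open>FI\<close> with
  \<open>FO\<close>. Because it is an involution, laws of injections and copairings can be read off
  the laws of projections and pairings.\<close>

primrec dual_fm :: "'l fm \<Rightarrow> 'l fm" where
  "dual_fm (Letter p) = Letter p"
| "dual_fm FI = FO"
| "dual_fm FO = FI"
| "dual_fm (A \<^bold>\<times> B) = dual_fm A \<^bold>+ dual_fm B"
| "dual_fm (A \<^bold>+ B) = dual_fm A \<^bold>\<times> dual_fm B"

text \<open>Contravariant: types and composites are reversed, but the left-to-right order of factors
  and summands is kept, so letters keep their positions.\<close>

primrec dual :: "'l tm \<Rightarrow> 'l tm" where
  "dual (IdT A) = IdT (dual_fm A)"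
| "dual (KT A) = LT (dual_fm A)"
| "dual (LT A) = KT (dual_fm A)"
| "dual (K1 A B) = L1 (dual_fm A) (dual_fm B)"
| "dual (K2 A B) = L2 (dual_fm A) (dual_fm B)"
| "dual (WT A) = MT (dual_fm A)"
| "dual (L1 A B) = K1 (dual_fm A) (dual_fm B)"
| "dual (L2 A B) = K2 (dual_fm A) (dual_fm B)"
| "dual (MT A) = WT (dual_fm A)"
| "dual (g \<cdot> f) = dual f \<cdot> dual g"
| "dual (f \<otimes> g) = dual f \<oplus> dual g"
| "dual (f \<oplus> g) = dual f \<otimes> dual g"

lemma dual_fm_dual_fm [simp]: "dual_fm (dual_fm A) = A"
  by (induction A) auto

lemma dual_dual [simp]: "dual (dual f) = f"
  by (induction f) auto

lemma dual_fm_formulae: "A \<in> formulae \<L> \<Longrightarrow> dual_fm A \<in> formulae \<L>"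
  by (induction rule: formulae.induct) (auto intro: formulae.intros)

lemma src_dual [simp]: "src (dual f) = dual_fm (tgt f)"
  and tgt_dual [simp]: "tgt (dual f) = dual_fm (src f)"
  by (induction f) auto

lemma typed_dual: "typed \<L> f A B \<Longrightarrow> typed \<L> (dual f) (dual_fm B) (dual_fm A)"
  by (induction rule: typed.induct) (auto intro: typed.intros dual_fm_formulae)

text \<open>The equations of a dicartesian category come in dual pairs; associativity is its own
  dual, read in the opposite direction.\<close>

lemma eqD_dual: "eqD \<L> A B f g \<Longrightarrow> eqD \<L> (dual_fm B) (dual_fm A) (dual f) (dual g)"
proof (induction rule: eqD.induct)
  case (eqD_trans A B f g h)
  then show ?case by (blast intro: eqD.eqD_trans)
next
  case (cat_assoc f A B g C h D)
  then show ?case by (auto intro!: eqD_sym[OF eqD.cat_assoc] typed_dual)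
next
  case (eqD_sym A B f g)
  then show ?case by (blast intro: eqD.eqD_sym)
next
  case (K_unique f A)
  then show ?case using L_unique typed_dual[OF K_unique] by auto
next
  case (L_unique f A)
  then show ?case using K_unique typed_dual[OF L_unique] by auto
qed (auto intro: eqD_refl cong_Comp cong_Times cong_Plus cat_left cat_right times_Id times_Comp
    K1_nat K2_nat W_nat K1_W K2_W K1_K2_W K_unique K1_K2_FO plus_Id plus_Comp L1_nat L2_nat M_nat
    M_L1 M_L2 M_L1_L2 L_unique L1_L2_FI typed_dual dual_fm_formulae)

lemma letter_count_dual_fm [simp]: "letter_count (dual_fm A) = letter_count A"
  by (induction A) auto

text \<open>Duality fixes the positions of letters and swaps source and target, hence it transposes
  the relation.\<close>

lemma G_dual: "G (dual f) = (G f)\<inverse>"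
  by (induction f) (auto simp: juxtapose_def)

section \<open>Soundness of the relational interpretation\<close>

lemma G_bound:
  "typed \<L> f A B \<Longrightarrow> (x, y) \<in> G f \<Longrightarrow> x < letter_count A \<and> y < letter_count B"
proof (induction arbitrary: x y rule: typed.induct)
  case (typed_Comp f A B g C)
  from typed_Comp.prems obtain z where "(x, z) \<in> G f" "(z, y) \<in> G g" by auto
  with typed_Comp.IH show ?case by blast
next
  case (typed_Times f A B g C D)
  then show ?case using typed_src_tgt[OF typed_Times.hyps(1)]
    by (fastforce simp: juxtapose_def)
next
  case (typed_Plus f A B g C D)
  then show ?case using typed_src_tgt[OF typed_Plus.hyps(1)]
    by (fastforce simp: juxtapose_def)
qed auto

lemma juxtapose_iff:
  "(x, y) \<in> juxtapose a b r s \<longleftrightarrow> (x, y) \<in> r \<or> a \<le> x \<and> b \<le> y \<and> (x - a, y - b) \<in> s"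
  unfolding juxtapose_def by simp (metis add_diff_cancel_right' le_add2 le_add_diff_inverse2)

text \<open>The bound \<open>b\<close> keeps the blocks apart at the middle object: an index below
  \<open>b\<close> occurs there only in \<open>r\<close> and \<open>r'\<close>, an index from
  \<open>b\<close> on only in the shifted copies of \<open>s\<close> and \<open>s'\<close>.\<close>

lemma juxtapose_relcomp:
  assumes "\<And>x y. (x, y) \<in> r \<Longrightarrow> y < b" and "\<And>x y. (x, y) \<in> r' \<Longrightarrow> x < b"
  shows "juxtapose a b r s O juxtapose b c r' s' = juxtapose a c (r O r') (s O s')"
proof (intro equalityI subrelI)
  fix x z assume "(x, z) \<in> juxtapose a b r s O juxtapose b c r' s'"
  then obtain y where "(x, y) \<in> juxtapose a b r s" "(y, z) \<in> juxtapose b c r' s'" by blast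
  then show "(x, z) \<in> juxtapose a c (r O r') (s O s')"
    unfolding juxtapose_iff using assms by (meson leD relcompI)
next
  fix x z assume "(x, z) \<in> juxtapose a c (r O r') (s O s')"
  then consider y where "(x, y) \<in> r" "(y, z) \<in> r'"
    | y where "a \<le> x" "c \<le> z" "(x - a, y) \<in> s" "(y, z - c) \<in> s'"
    unfolding juxtapose_iff by blast
  then show "(x, z) \<in> juxtapose a b r s O juxtapose b c r' s'"
  proof cases
    case 1
    then show ?thesis by (auto simp: juxtapose_iff)
  next
    case (2 y)
    \<comment> \<open>The intermediate point of the second block is \<open>y\<close> moved past the
      first block of the middle object.\<close>
    then have "(x, y + b) \<in> juxtapose a b r s" "(y + b, z) \<in> juxtapose b c r' s'"
      by (auto simp: juxtapose_iff)
    then show ?thesis by blast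
  qed
qed

lemma G_Id_relcomp:
  assumes "typed \<L> f A B"
  shows "{(x, x) |x. x < letter_count A} O G f = G f"
    and "G f O {(x, x) |x. x < letter_count B} = G f"
  using G_bound[OF assms] by auto

lemma G_comp_K1:
  assumes "typed \<L> f A C"
  shows "G (f \<cdot> K1 A B) = G f"
  using G_bound[OF assms] by auto

lemma G_comp_K2:
  assumes "typed \<L> f B C"
  shows "G (f \<cdot> K2 A B) = {(x + letter_count A, y) |x y. (x, y) \<in> G f}"
  using G_bound[OF assms] by fastforce

lemma G_comp_W:
  assumes "typed \<L> f C A" and "typed \<L> g C B"
  shows "G ((f \<otimes> g) \<cdot> WT C) = G f \<union> {(x, y + letter_count A) |x y. (x, y) \<in> G g}"
proof -
  have "src f = C" "tgt f = A" using typed_src_tgt[OF assms(1)] by auto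
  then show ?thesis
    using G_bound[OF assms(1)] G_bound[OF assms(2)]
    by (auto simp: juxtapose_def; force)
qed

lemma G_K1_nat:
  assumes "typed \<L> f A B" and "typed \<L> g C D"
  shows "G (K1 B D \<cdot> (f \<otimes> g)) = G (f \<cdot> K1 A C)"
  unfolding G_comp_K1[OF assms(1)]
  using G_bound[OF assms(1)] G_bound[OF assms(2)] typed_src_tgt[OF assms(1)]
  by (auto simp: juxtapose_def)

lemma G_K2_nat:
  assumes "typed \<L> f A B" and "typed \<L> g C D"
  shows "G (K2 B D \<cdot> (f \<otimes> g)) = G (g \<cdot> K2 A C)"
  unfolding G_comp_K2[OF assms(2)]
  using G_bound[OF assms(1)] G_bound[OF assms(2)] typed_src_tgt[OF assms(1)]
  by (auto simp: juxtapose_def; fastforce)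

lemma G_W_nat:
  assumes "typed \<L> f A B"
  shows "G (WT B \<cdot> f) = G ((f \<otimes> f) \<cdot> WT A)"
  unfolding G_comp_W[OF assms assms] using G_bound[OF assms] by auto

lemma G_K1_K2_W:
  assumes "A \<in> formulae \<L>" and "B \<in> formulae \<L>"
  shows "G ((K1 A B \<otimes> K2 A B) \<cdot> WT (A \<^bold>\<times> B)) = G (IdT (A \<^bold>\<times> B))"
  unfolding G_comp_W[OF typed_K1[OF assms] typed_K2[OF assms]]
  by auto presburger

lemma dual_G_eqI: "G (dual f) = G (dual g) \<Longrightarrow> G f = G g"
  by (simp add: G_dual)

text \<open>Soundness. In the congruence cases the types must agree because the shifts in a
  juxtaposition are read off \<open>src\<close> and \<open>tgt\<close>. An arrow into
  \<open>FI\<close> or out of \<open>FO\<close> has empty relation because these formulae have no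
  letters. Several coproduct axioms are transposed product axioms.\<close>

lemma G_eqD: "eqD \<L> A B f g \<Longrightarrow> G f = G g"
proof (induction rule: eqD.induct)
  case (cong_Times A B f f' C D g g')
  then have "src f = src f'" "tgt f = tgt f'"
    using eqD_typed typed_src_tgt by metis+
  with cong_Times show ?case by simp
next
  case (cong_Plus A B f f' C D g g')
  then have "src f = src f'" "tgt f = tgt f'"
    using eqD_typed typed_src_tgt by metis+
  with cong_Plus show ?case by simp
next
  case (cat_left f A B) then show ?case by (simp add: G_Id_relcomp)
next
  case (cat_right f A B) then show ?case by (simp add: G_Id_relcomp)
next
  case (cat_assoc f A B g C h D) then show ?case by (simp add: O_assoc)
next
  case (times_Comp g\<^sub>2 A B g\<^sub>1 C f\<^sub>2 A' B' f\<^sub>1 C')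
  then show ?case
    using typed_src_tgt[OF times_Comp(1)] typed_src_tgt[OF times_Comp(2)]
    by simp (rule juxtapose_relcomp[symmetric], auto dest: G_bound)
next
  case (plus_Comp g\<^sub>2 A B g\<^sub>1 C f\<^sub>2 A' B' f\<^sub>1 C')
  then show ?case
    using typed_src_tgt[OF plus_Comp(1)] typed_src_tgt[OF plus_Comp(2)]
    by simp (rule juxtapose_relcomp[symmetric], auto dest: G_bound)
next
  case (K1_nat f A B g C D) then show ?case by (rule G_K1_nat)
next
  case (K2_nat f A B g C D) then show ?case by (rule G_K2_nat)
next
  case (W_nat f A B) then show ?case by (rule G_W_nat)
next
  case (K1_K2_W A B) then show ?case by (rule G_K1_K2_W)
next
  case (L1_nat f A B g C D)
  show ?case
    using G_K1_nat[OF typed_dual[OF L1_nat(1)] typed_dual[OF L1_nat(2)]]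
    by - (rule dual_G_eqI, simp only: dual.simps dual_fm.simps)
next
  case (L2_nat f A B g C D)
  show ?case
    using G_K2_nat[OF typed_dual[OF L2_nat(1)] typed_dual[OF L2_nat(2)]]
    by - (rule dual_G_eqI, simp only: dual.simps dual_fm.simps)
next
  case (M_nat f A B)
  show ?case
    using G_W_nat[OF typed_dual[OF M_nat]]
    by - (rule dual_G_eqI, simp only: dual.simps dual_fm.simps)
next
  case (M_L1_L2 A B)
  show ?case
    using G_K1_K2_W[OF dual_fm_formulae[OF M_L1_L2(1)] dual_fm_formulae[OF M_L1_L2(2)]]
    by - (rule dual_G_eqI, simp only: dual.simps dual_fm.simps)
next
  case (K_unique f A) then show ?case using G_bound[OF K_unique] by auto
next
  case (L_unique f A) then show ?case using G_bound[OF L_unique] by auto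
next
  case (times_Id A B)
  show ?case by (auto simp: juxtapose_iff)
next
  case (plus_Id A B)
  show ?case by (auto simp: juxtapose_iff)
qed (auto simp: juxtapose_def)

subsection \<open>Pairing and copairing\<close>

declare eqD_trans [trans]

lemma cong_post: "eqD \<L> A B f f' \<Longrightarrow> typed \<L> g B C \<Longrightarrow> eqD \<L> A C (g \<cdot> f) (g \<cdot> f')"
  by (intro cong_Comp eqD_refl)

lemma cong_pre: "eqD \<L> B C g g' \<Longrightarrow> typed \<L> f A B \<Longrightarrow> eqD \<L> A C (g \<cdot> f) (g' \<cdot> f)"
  by (intro cong_Comp eqD_refl)

text \<open>The index of a projection is a Boolean, \<open>True\<close> for the first, so that one
  argument covers both projections and \<open>\<not> i\<close> names the other one;
  \<open>incl\<close> and \<open>sel\<close> follow the same convention.\<close>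

definition proj :: "bool \<Rightarrow> 'l fm \<Rightarrow> 'l fm \<Rightarrow> 'l tm" where
  "proj i A B = (if i then K1 A B else K2 A B)"

definition incl :: "bool \<Rightarrow> 'l fm \<Rightarrow> 'l fm \<Rightarrow> 'l tm" where
  "incl i A B = (if i then L1 A B else L2 A B)"

definition sel :: "bool \<Rightarrow> 'a \<Rightarrow> 'a \<Rightarrow> 'a" where
  "sel i a b = (if i then a else b)"

lemma sel_simps [simp]: "sel True a b = a" "sel False a b = b"
  by (simp_all add: sel_def)

definition pair :: "'l tm \<Rightarrow> 'l tm \<Rightarrow> 'l tm" where
  "pair f g = (f \<otimes> g) \<cdot> WT (src f)"

definition copair :: "'l tm \<Rightarrow> 'l tm \<Rightarrow> 'l tm" where
  "copair f g = MT (tgt f) \<cdot> (f \<oplus> g)"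

lemma dual_proj [simp]: "dual (proj i A B) = incl i (dual_fm A) (dual_fm B)"
  and dual_incl [simp]: "dual (incl i A B) = proj i (dual_fm A) (dual_fm B)"
  and dual_pair [simp]: "dual (pair f g) = copair (dual f) (dual g)"
  and dual_copair [simp]: "dual (copair f g) = pair (dual f) (dual g)"
  and dual_fm_sel [simp]: "dual_fm (sel i A B) = sel i (dual_fm A) (dual_fm B)"
  and dual_sel [simp]: "dual (sel i f g) = sel i (dual f) (dual g)"
  by (simp_all add: proj_def incl_def sel_def pair_def copair_def)

lemma typed_proj:
  "A \<in> formulae \<L> \<Longrightarrow> B \<in> formulae \<L> \<Longrightarrow> typed \<L> (proj i A B) (A \<^bold>\<times> B) (sel i A B)"
  by (cases i) (auto simp: proj_def intro: typed.intros)

lemma typed_incl: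
  "A \<in> formulae \<L> \<Longrightarrow> B \<in> formulae \<L> \<Longrightarrow> typed \<L> (incl i A B) (sel i A B) (A \<^bold>+ B)"
  by (cases i) (auto simp: incl_def intro: typed.intros)

lemma pair_eq: "typed \<L> f C A \<Longrightarrow> pair f g = (f \<otimes> g) \<cdot> WT C"
  by (auto simp: pair_def dest: typed_src_tgt)

lemma typed_pair: "typed \<L> f C A \<Longrightarrow> typed \<L> g C B \<Longrightarrow> typed \<L> (pair f g) C (A \<^bold>\<times> B)"
  using typed_formulae[of \<L> f C A]
  by (simp add: pair_eq) (blast intro: typed_Comp[OF typed_W typed_Times])

text \<open>Dualising twice is the identity, so a goal about copairings may be replaced by its dual
  about pairings.\<close>

lemma eqD_dualI:
  "eqD \<L> (dual_fm B) (dual_fm A) (dual f) (dual g) \<Longrightarrow> eqD \<L> A B f g"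
  using eqD_dual by fastforce

lemma typed_dualI: "typed \<L> (dual f) (dual_fm B) (dual_fm A) \<Longrightarrow> typed \<L> f A B"
  using typed_dual by fastforce

lemma typed_copair: "typed \<L> f A C \<Longrightarrow> typed \<L> g B C \<Longrightarrow> typed \<L> (copair f g) (A \<^bold>+ B) C"
  by (rule typed_dualI) (simp add: typed_pair typed_dual)

lemma cong_pair:
  assumes "eqD \<L> C A f f'" and "eqD \<L> C B g g'"
  shows "eqD \<L> C (A \<^bold>\<times> B) (pair f g) (pair f' g')"
proof -
  have "typed \<L> f C A" "typed \<L> f' C A" using eqD_typed[OF assms(1)] by auto
  then show ?thesis
    using typed_formulae[of \<L> f C A]
    by (simp add: pair_eq cong_pre[OF cong_Times[OF assms] typed_W])
qed

lemma cong_copair: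
  "eqD \<L> A C f f' \<Longrightarrow> eqD \<L> B C g g' \<Longrightarrow> eqD \<L> (A \<^bold>+ B) C (copair f g) (copair f' g')"
  by (rule eqD_dualI) (simp add: cong_pair eqD_dual)

text \<open>Naturality of the diagonal moves \<open>h\<close> past \<open>WT\<close>, and
  functoriality of the product distributes it over the two components.\<close>

lemma pair_comp:
  assumes h: "typed \<L> h D C" and f: "typed \<L> f C A" and g: "typed \<L> g C B"
  shows "eqD \<L> D (A \<^bold>\<times> B) (pair f g \<cdot> h) (pair (f \<cdot> h) (g \<cdot> h))"
proof -
  have C: "C \<in> formulae \<L>" and D: "D \<in> formulae \<L>" using typed_formulae[OF h] by auto
  note ts = f g h typed_W[OF C] typed_W[OF D] typed_Times typed_Comp
  have "eqD \<L> D (A \<^bold>\<times> B) (pair f g \<cdot> h) ((f \<otimes> g) \<cdot> (WT C \<cdot> h))"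
    unfolding pair_eq[OF f] by (rule eqD_sym, rule cat_assoc) (rule ts | rule ts(6))+
  also have "eqD \<L> D (A \<^bold>\<times> B) \<dots> ((f \<otimes> g) \<cdot> ((h \<otimes> h) \<cdot> WT D))"
    by (rule cong_post[OF W_nat[OF h] typed_Times[OF f g]])
  also have "eqD \<L> D (A \<^bold>\<times> B) \<dots> (((f \<otimes> g) \<cdot> (h \<otimes> h)) \<cdot> WT D)"
    by (rule cat_assoc[OF typed_W[OF D] typed_Times[OF h h] typed_Times[OF f g]])
  also have "eqD \<L> D (A \<^bold>\<times> B) \<dots> (((f \<cdot> h) \<otimes> (g \<cdot> h)) \<cdot> WT D)"
    by (rule cong_pre[OF eqD_sym[OF times_Comp[OF h f h g]] typed_W[OF D]])
  finally show ?thesis unfolding pair_eq[OF typed_Comp[OF h f]] .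
qed

lemma comp_copair:
  assumes "typed \<L> h C D" and "typed \<L> f A C" and "typed \<L> g B C"
  shows "eqD \<L> (A \<^bold>+ B) D (h \<cdot> copair f g) (copair (h \<cdot> f) (h \<cdot> g))"
  using pair_comp[OF typed_dual[OF assms(1)] typed_dual[OF assms(2)] typed_dual[OF assms(3)]]
  by - (rule eqD_dualI, simp)

text \<open>Naturality of the projection carries it past \<open>f \<otimes> g\<close>, after which
  it cancels against the diagonal.\<close>

lemma proj_pair:
  assumes f: "typed \<L> f C A" and g: "typed \<L> g C B"
  shows "eqD \<L> C (sel i A B) (proj i A B \<cdot> pair f g) (sel i f g)"
proof -
  have A: "A \<in> formulae \<L>" and B: "B \<in> formulae \<L>" and C: "C \<in> formulae \<L>"
    using typed_formulae f g by auto
  have s: "typed \<L> (sel i f g) C (sel i A B)" using f g by (cases i) auto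
  have prC: "typed \<L> (proj i C C) (C \<^bold>\<times> C) C" using typed_proj[OF C C, of i] by (cases i) auto
  have "eqD \<L> C (sel i A B) (proj i A B \<cdot> pair f g) ((proj i A B \<cdot> (f \<otimes> g)) \<cdot> WT C)"
    unfolding pair_eq[OF f]
    by (rule cat_assoc[OF typed_W[OF C] typed_Times[OF f g] typed_proj[OF A B]])
  also have "eqD \<L> C (sel i A B) \<dots> ((sel i f g \<cdot> proj i C C) \<cdot> WT C)"
    using K1_nat[OF f g] K2_nat[OF f g]
    by (intro cong_pre[OF _ typed_W[OF C]]) (auto simp: proj_def sel_def)
  also have "eqD \<L> C (sel i A B) \<dots> (sel i f g \<cdot> (proj i C C \<cdot> WT C))"
    by (rule eqD_sym[OF cat_assoc[OF typed_W[OF C] prC s]])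
  also have "eqD \<L> C (sel i A B) \<dots> (sel i f g \<cdot> IdT C)"
    using K1_W[OF C] K2_W[OF C] by (intro cong_post[OF _ s]) (auto simp: proj_def)
  also have "eqD \<L> C (sel i A B) \<dots> (sel i f g)"
    by (rule cat_right[OF s])
  finally show ?thesis .
qed

lemma copair_incl:
  assumes "typed \<L> f A C" and "typed \<L> g B C"
  shows "eqD \<L> (sel i A B) C (copair f g \<cdot> incl i A B) (sel i f g)"
  using proj_pair[OF typed_dual[OF assms(1)] typed_dual[OF assms(2)], of i]
  by - (rule eqD_dualI, simp)

text \<open>Surjective pairing: the axiom \<open>K1_K2_W\<close> precomposed with
  \<open>f\<close>.\<close>

lemma pair_eta:
  assumes f: "typed \<L> f C (A \<^bold>\<times> B)"
  shows "eqD \<L> C (A \<^bold>\<times> B) f (pair (K1 A B \<cdot> f) (K2 A B \<cdot> f))"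
proof -
  have A: "A \<in> formulae \<L>" and B: "B \<in> formulae \<L>"
    using typed_formulae[OF f] by (auto elim: formulae.cases)
  have "eqD \<L> C (A \<^bold>\<times> B) f (IdT (A \<^bold>\<times> B) \<cdot> f)"
    by (rule eqD_sym[OF cat_left[OF f]])
  also have "eqD \<L> C (A \<^bold>\<times> B) \<dots> (pair (K1 A B) (K2 A B) \<cdot> f)"
    unfolding pair_eq[OF typed_K1[OF A B]]
    by (rule cong_pre[OF eqD_sym[OF K1_K2_W[OF A B]] f])
  also have "eqD \<L> C (A \<^bold>\<times> B) \<dots> (pair (K1 A B \<cdot> f) (K2 A B \<cdot> f))"
    by (rule pair_comp[OF f typed_K1[OF A B] typed_K2[OF A B]])
  finally show ?thesis .
qed

lemma copair_eta:
  assumes "typed \<L> f (A \<^bold>+ B) C"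
  shows "eqD \<L> (A \<^bold>+ B) C f (copair (f \<cdot> L1 A B) (f \<cdot> L2 A B))"
  using pair_eta[of \<L> "dual f" "dual_fm C" "dual_fm A" "dual_fm B"] typed_dual[OF assms]
  by - (rule eqD_dualI, simp)

text \<open>This is the content of the axiom \<open>K1_K2_FO\<close>: \<open>f\<close> and
  \<open>g\<close> are the two components of one pairing into \<open>FO\<close> times
  \<open>FO\<close>, whose projections coincide.\<close>

lemma to_FO_unique:
  assumes f: "typed \<L> f A FO" and g: "typed \<L> g A FO"
  shows "eqD \<L> A FO f g"
proof -
  have "eqD \<L> A FO f (K1 FO FO \<cdot> pair f g)"
    using eqD_sym[OF proj_pair[OF f g, of True]] by (simp add: proj_def)
  also have "eqD \<L> A FO \<dots> (K2 FO FO \<cdot> pair f g)"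
    by (rule cong_pre[OF K1_K2_FO typed_pair[OF f g]])
  also have "eqD \<L> A FO \<dots> g"
    using proj_pair[OF f g, of False] by (simp add: proj_def)
  finally show ?thesis .
qed

lemma Times_formulae: "A \<^bold>\<times> B \<in> formulae \<L> \<longleftrightarrow> A \<in> formulae \<L> \<and> B \<in> formulae \<L>"
  by (auto elim: formulae.cases intro: formulae.intros)

lemma Plus_formulae: "A \<^bold>+ B \<in> formulae \<L> \<longleftrightarrow> A \<in> formulae \<L> \<and> B \<in> formulae \<L>"
  by (auto elim: formulae.cases intro: formulae.intros)

subsection \<open>Cut elimination\<close>

text \<open>Cut-free terms, closed under equality in \<open>\<D>\<close>, so that every typed term satisfies \<open>nf\<close> and
  \<open>nf.induct\<close> becomes an induction principle for typed terms.\<close>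

inductive nf :: "'l set \<Rightarrow> 'l fm \<Rightarrow> 'l fm \<Rightarrow> 'l tm \<Rightarrow> bool" for \<L> :: "'l set" where
  nf_Id: "p \<in> \<L> \<Longrightarrow> nf \<L> (Letter p) (Letter p) (IdT (Letter p))"
| nf_K: "A \<in> formulae \<L> \<Longrightarrow> nf \<L> A FI (KT A)"
| nf_L: "A \<in> formulae \<L> \<Longrightarrow> nf \<L> FO A (LT A)"
| nf_proj: "\<lbrakk>A \<in> formulae \<L>; B \<in> formulae \<L>; nf \<L> (sel i A B) C f\<rbrakk>
    \<Longrightarrow> nf \<L> (A \<^bold>\<times> B) C (f \<cdot> proj i A B)"
| nf_incl: "\<lbrakk>A \<in> formulae \<L>; B \<in> formulae \<L>; nf \<L> C (sel i A B) f\<rbrakk>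
    \<Longrightarrow> nf \<L> C (A \<^bold>+ B) (incl i A B \<cdot> f)"
| nf_pair: "\<lbrakk>nf \<L> C A f; nf \<L> C B g\<rbrakk> \<Longrightarrow> nf \<L> C (A \<^bold>\<times> B) (pair f g)"
| nf_copair: "\<lbrakk>nf \<L> A C f; nf \<L> B C g\<rbrakk> \<Longrightarrow> nf \<L> (A \<^bold>+ B) C (copair f g)"
| nf_eq: "\<lbrakk>nf \<L> A B f; eqD \<L> A B f g\<rbrakk> \<Longrightarrow> nf \<L> A B g"

lemma nf_typed: "nf \<L> A B f \<Longrightarrow> typed \<L> f A B"
  by (induction rule: nf.induct)
    (auto intro: typed.intros formulae.intros typed_proj typed_incl typed_pair typed_copair
      dest: eqD_typed)

text \<open>The half of cut elimination that looks at the last step of \<open>g\<close>. Steps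
  acting on the target are permuted outwards past \<open>f\<close>. The steps that analyse the
  middle formula \<open>B\<close> depend on the shape of \<open>f\<close> and are left as
  hypotheses; these quantify over the target because it changes during the induction.\<close>

lemma nf_comp_post:
  assumes "nf \<L> B C g" and "typed \<L> f A B"
    and "\<And>p. B = Letter p \<Longrightarrow> nf \<L> A B f"
    and "\<And>C. B = FO \<Longrightarrow> C \<in> formulae \<L> \<Longrightarrow> nf \<L> A C (LT C \<cdot> f)"
    and "\<And>B\<^sub>1 B\<^sub>2 C i g. B = B\<^sub>1 \<^bold>\<times> B\<^sub>2 \<Longrightarrow> nf \<L> (sel i B\<^sub>1 B\<^sub>2) C g \<Longrightarrow> nf \<L> A C ((g \<cdot> proj i B\<^sub>1 B\<^sub>2) \<cdot> f)"
    and "\<And>B\<^sub>1 B\<^sub>2 C g h. B = B\<^sub>1 \<^bold>+ B\<^sub>2 \<Longrightarrow> nf \<L> B\<^sub>1 C g \<Longrightarrow> nf \<L> B\<^sub>2 C h \<Longrightarrow> nf \<L> A C (copair g h \<cdot> f)"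
  shows "nf \<L> A C (g \<cdot> f)"
  using assms
proof (induction rule: nf.induct)
  case (nf_Id p)
  then show ?case by (metis nf_eq cat_left eqD_sym)
next
  case (nf_K B)
  then show ?case
    by (metis nf_eq nf.nf_K K_unique eqD_sym typed_Comp typed_K typed_formulae)
next
  case (nf_incl B\<^sub>1 B\<^sub>2 C i g)
  show ?case
    by (rule nf_eq[OF nf.nf_incl[OF nf_incl.hyps(1,2) nf_incl.IH[OF nf_incl.prems]]
      cat_assoc[OF nf_incl.prems(1) nf_typed[OF nf_incl.hyps(3)] typed_incl[OF nf_incl.hyps(1,2)]]])
next
  case (nf_pair C A g B h)
  show ?case
    by (rule nf_eq[OF nf.nf_pair[OF nf_pair.IH(1)[OF nf_pair.prems] nf_pair.IH(2)[OF nf_pair.prems]]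
      eqD_sym[OF pair_comp[OF nf_pair.prems(1) nf_typed[OF nf_pair.hyps(1)] nf_typed[OF nf_pair.hyps(2)]]]])
next
  case (nf_eq B C g h)
  show ?case
    by (rule nf.nf_eq[OF nf_eq.IH[OF nf_eq.prems] cong_pre[OF nf_eq.hyps(2) nf_eq.prems(1)]])
qed auto

text \<open>Induction on the cut-free form of \<open>f\<close>. Steps of \<open>f\<close> that act
  on its source are permuted past \<open>g\<close>; when \<open>f\<close> ends in a step that builds
  its target, \<open>nf_comp_post\<close> reduces matters to the cuts where both terms treat the
  same connective.\<close>

lemma nf_comp: "nf \<L> A B f \<Longrightarrow> nf \<L> B C g \<Longrightarrow> nf \<L> A C (g \<cdot> f)"
proof (induction arbitrary: C g rule: nf.induct)
  case (nf_Id p)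
  then show ?case by (metis nf_eq cat_right eqD_sym nf_typed)
next
  case (nf_K A)
  \<comment> \<open>The middle formula is \<open>FI\<close>, so none of the shapes in the hypotheses
    of \<open>nf_comp_post\<close> can occur.\<close>
  show ?case
    by (rule nf_comp_post[OF nf_K.prems typed_K[OF nf_K.hyps]]) auto
next
  case (nf_L A)
  then show ?case
    by (metis nf_eq nf.nf_L L_unique eqD_sym typed_Comp nf_typed typed_L typed_formulae)
next
  case (nf_proj A\<^sub>1 A\<^sub>2 i B f)
  show ?case
    by (rule nf_eq[OF nf.nf_proj[OF nf_proj.hyps(1,2) nf_proj.IH[OF nf_proj.prems]]
      eqD_sym[OF cat_assoc[OF typed_proj[OF nf_proj.hyps(1,2)] nf_typed[OF nf_proj.hyps(3)] nf_typed[OF nf_proj.prems]]]])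
next
  case (nf_incl B\<^sub>1 B\<^sub>2 A i f)
  have f: "typed \<L> f A (sel i B\<^sub>1 B\<^sub>2)" by (rule nf_typed[OF nf_incl.hyps(3)])
  have j: "typed \<L> (incl i B\<^sub>1 B\<^sub>2) (sel i B\<^sub>1 B\<^sub>2) (B\<^sub>1 \<^bold>+ B\<^sub>2)" by (rule typed_incl[OF nf_incl.hyps(1,2)])
  \<comment> \<open>Principal cut: the copairing meets an injection and selects a component, leaving
    a cut with the smaller term \<open>f\<close>.\<close>
  have *: "nf \<L> A C (copair g h \<cdot> (incl i B\<^sub>1 B\<^sub>2 \<cdot> f))" if g: "nf \<L> B\<^sub>1 C g" and h: "nf \<L> B\<^sub>2 C h" for C g h
  proof -
    have "eqD \<L> A C (copair g h \<cdot> (incl i B\<^sub>1 B\<^sub>2 \<cdot> f)) ((copair g h \<cdot> incl i B\<^sub>1 B\<^sub>2) \<cdot> f)"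
      by (rule cat_assoc[OF f j typed_copair[OF nf_typed[OF g] nf_typed[OF h]]])
    also have "eqD \<L> A C \<dots> (sel i g h \<cdot> f)"
      by (rule cong_pre[OF copair_incl[OF nf_typed[OF g] nf_typed[OF h]] f])
    finally show ?thesis
      by (rule nf_eq[OF _ eqD_sym, rotated]) (rule nf_incl.IH, cases i, auto simp: g h)
  qed
  show ?case
    by (rule nf_comp_post[OF nf_incl.prems typed_Comp[OF f j]]) (auto intro: *)
next
  case (nf_pair A B\<^sub>1 f\<^sub>1 B\<^sub>2 f\<^sub>2)
  have f: "typed \<L> f\<^sub>1 A B\<^sub>1" "typed \<L> f\<^sub>2 A B\<^sub>2" using nf_pair.hyps nf_typed by auto
  have B: "B\<^sub>1 \<in> formulae \<L>" "B\<^sub>2 \<in> formulae \<L>" using f typed_formulae by auto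
  \<comment> \<open>Principal cut: the projection selects one component of the pairing, for which an
    induction hypothesis is available.\<close>
  have *: "nf \<L> A C ((g \<cdot> proj i B\<^sub>1 B\<^sub>2) \<cdot> pair f\<^sub>1 f\<^sub>2)" if g: "nf \<L> (sel i B\<^sub>1 B\<^sub>2) C g" for C g i
  proof -
    have "eqD \<L> A C (g \<cdot> (proj i B\<^sub>1 B\<^sub>2 \<cdot> pair f\<^sub>1 f\<^sub>2)) ((g \<cdot> proj i B\<^sub>1 B\<^sub>2) \<cdot> pair f\<^sub>1 f\<^sub>2)"
      by (rule cat_assoc[OF typed_pair[OF f] typed_proj[OF B] nf_typed[OF g]])
    moreover have "eqD \<L> A C (g \<cdot> (proj i B\<^sub>1 B\<^sub>2 \<cdot> pair f\<^sub>1 f\<^sub>2)) (g \<cdot> sel i f\<^sub>1 f\<^sub>2)"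
      by (rule cong_post[OF proj_pair[OF f] nf_typed[OF g]])
    moreover have "nf \<L> A C (g \<cdot> sel i f\<^sub>1 f\<^sub>2)"
      using g nf_pair.IH by (cases i) auto
    ultimately show ?thesis by (metis nf_eq eqD_sym eqD_trans)
  qed
  show ?case
    by (rule nf_comp_post[OF nf_pair.prems typed_pair[OF f]]) (auto intro: *)
next
  case (nf_copair A\<^sub>1 B f\<^sub>1 A\<^sub>2 f\<^sub>2)
  show ?case
    by (rule nf_eq[OF nf.nf_copair[OF nf_copair.IH(1)[OF nf_copair.prems] nf_copair.IH(2)[OF nf_copair.prems]]
      eqD_sym[OF comp_copair[OF nf_typed[OF nf_copair.prems] nf_typed[OF nf_copair.hyps(1)] nf_typed[OF nf_copair.hyps(2)]]]])
next
  case (nf_eq A B f h)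
  show ?case
    by (rule nf.nf_eq[OF nf_eq.IH[OF nf_eq.prems] cong_post[OF nf_eq.hyps(2) nf_typed[OF nf_eq.prems]]])
qed

text \<open>Eta-expansion, since identities are primitive cut-free terms at letters only.\<close>

lemma nf_IdT: "A \<in> formulae \<L> \<Longrightarrow> nf \<L> A A (IdT A)"
proof (induction rule: formulae.induct)
  case 2
  show ?case by (rule nf_eq[OF nf_K eqD_sym[OF K_unique]]) (auto intro: formulae.intros typed_Id)
next
  case 3
  show ?case by (rule nf_eq[OF nf_L eqD_sym[OF L_unique]]) (auto intro: formulae.intros typed_Id)
next
  case (4 A B)
  have "nf \<L> (A \<^bold>\<times> B) (A \<^bold>\<times> B) (pair (IdT A \<cdot> proj True A B) (IdT B \<cdot> proj False A B))"
    using 4 by (intro nf_pair nf_proj) auto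
  moreover have "eqD \<L> (A \<^bold>\<times> B) (A \<^bold>\<times> B) (pair (IdT A \<cdot> proj True A B) (IdT B \<cdot> proj False A B))
      (pair (proj True A B) (proj False A B))"
    using 4(1,2) typed_proj[of A \<L> B True] typed_proj[of A \<L> B False] by (intro cong_pair cat_left) auto
  moreover have "eqD \<L> (A \<^bold>\<times> B) (A \<^bold>\<times> B) (pair (proj True A B) (proj False A B)) (IdT (A \<^bold>\<times> B))"
    using 4(1,2) K1_K2_W[OF 4(1,2)] pair_eq[OF typed_K1[OF 4(1,2)]] by (simp add: proj_def)
  ultimately show ?case by (blast intro: nf_eq)
next
  case (5 A B)
  have "nf \<L> (A \<^bold>+ B) (A \<^bold>+ B) (copair (incl True A B \<cdot> IdT A) (incl False A B \<cdot> IdT B))"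
    using 5 by (intro nf_copair nf_incl) auto
  moreover have "eqD \<L> (A \<^bold>+ B) (A \<^bold>+ B) (copair (incl True A B \<cdot> IdT A) (incl False A B \<cdot> IdT B))
      (copair (incl True A B) (incl False A B))"
    using 5(1,2) typed_incl[of A \<L> B True] typed_incl[of A \<L> B False] by (intro cong_copair cat_right) auto
  moreover have "eqD \<L> (A \<^bold>+ B) (A \<^bold>+ B) (copair (incl True A B) (incl False A B)) (IdT (A \<^bold>+ B))"
    using 5(1,2) M_L1_L2[OF 5(1,2)] by (simp add: incl_def copair_def)
  ultimately show ?case by (blast intro: nf_eq)
qed (auto intro: nf_Id)

lemma nf_proj_term: "A \<in> formulae \<L> \<Longrightarrow> B \<in> formulae \<L> \<Longrightarrow> nf \<L> (A \<^bold>\<times> B) (sel i A B) (proj i A B)"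
  by (rule nf_eq[OF nf_proj[OF _ _ nf_IdT] cat_left[OF typed_proj]]) (cases i; simp)+

lemma nf_incl_term: "A \<in> formulae \<L> \<Longrightarrow> B \<in> formulae \<L> \<Longrightarrow> nf \<L> (sel i A B) (A \<^bold>+ B) (incl i A B)"
  by (rule nf_eq[OF nf_incl[OF _ _ nf_IdT] cat_right[OF typed_incl]]) (cases i; simp)+

text \<open>Composition is covered by \<open>nf_comp\<close>. The other constructors are rewritten
  with pairing and copairing; for instance \<open>f \<otimes> g\<close> is the pairing of
  \<open>f\<close> and \<open>g\<close> precomposed with the projections.\<close>

lemma typed_nf: "typed \<L> f A B \<Longrightarrow> nf \<L> A B f"
proof (induction rule: typed.induct)
  case (typed_K1 A B) then show ?case using nf_proj_term[of A \<L> B True] by (simp add: proj_def)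
next
  case (typed_K2 A B) then show ?case using nf_proj_term[of A \<L> B False] by (simp add: proj_def)
next
  case (typed_L1 A B) then show ?case using nf_incl_term[of A \<L> B True] by (simp add: incl_def)
next
  case (typed_L2 A B) then show ?case using nf_incl_term[of A \<L> B False] by (simp add: incl_def)
next
  case (typed_W A)
  have "eqD \<L> A (A \<^bold>\<times> A) (pair (IdT A) (IdT A)) (WT A)"
    using cong_pre[OF times_Id[OF typed_W typed_W] typed.typed_W[OF typed_W]]
      cat_left[OF typed.typed_W[OF typed_W]]
    by (auto simp: pair_def intro: eqD_trans)
  then show ?case by (blast intro: nf_eq nf_pair nf_IdT typed_W)
next
  case (typed_M A)
  have "eqD \<L> (A \<^bold>+ A) A (copair (IdT A) (IdT A)) (MT A)"
    using cong_post[OF plus_Id[OF typed_M typed_M] typed.typed_M[OF typed_M]]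
      cat_right[OF typed.typed_M[OF typed_M]]
    by (auto simp: copair_def intro: eqD_trans)
  then show ?case by (blast intro: nf_eq nf_copair nf_IdT typed_M)
next
  case (typed_Times f A B g C D)
  note ty = typed_Times.hyps
  have fm: "A \<in> formulae \<L>" "B \<in> formulae \<L>" "C \<in> formulae \<L>" "D \<in> formulae \<L>"
    using typed_formulae ty by auto
  have "eqD \<L> (A \<^bold>\<times> C) (B \<^bold>\<times> D) (pair (f \<cdot> K1 A C) (g \<cdot> K2 A C)) (f \<otimes> g)"
    by (rule eqD_trans[OF eqD_sym[OF cong_pair[OF K1_nat[OF ty] K2_nat[OF ty]]]
      eqD_sym[OF pair_eta[OF typed.typed_Times[OF ty]]]])
  moreover have "nf \<L> (A \<^bold>\<times> C) (B \<^bold>\<times> D) (pair (f \<cdot> K1 A C) (g \<cdot> K2 A C))"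
    using nf_proj_term[OF fm(1,3), of True] nf_proj_term[OF fm(1,3), of False] typed_Times.IH
    by (intro nf_pair nf_comp) (auto simp: proj_def)
  ultimately show ?case by (blast intro: nf_eq)
next
  case (typed_Plus f A B g C D)
  note ty = typed_Plus.hyps
  have fm: "A \<in> formulae \<L>" "B \<in> formulae \<L>" "C \<in> formulae \<L>" "D \<in> formulae \<L>"
    using typed_formulae ty by auto
  have "eqD \<L> (A \<^bold>+ C) (B \<^bold>+ D) (copair (L1 B D \<cdot> f) (L2 B D \<cdot> g)) (f \<oplus> g)"
    by (rule eqD_trans[OF eqD_sym[OF cong_copair[OF L1_nat[OF ty] L2_nat[OF ty]]]
      eqD_sym[OF copair_eta[OF typed.typed_Plus[OF ty]]]])
  moreover have "nf \<L> (A \<^bold>+ C) (B \<^bold>+ D) (copair (L1 B D \<cdot> f) (L2 B D \<cdot> g))"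
    using nf_incl_term[OF fm(2,4), of True] nf_incl_term[OF fm(2,4), of False] typed_Plus.IH
    by (intro nf_copair nf_comp) (auto simp: incl_def)
  ultimately show ?case by (blast intro: nf_eq)
qed (auto intro: nf_IdT nf_K nf_L nf_comp)

section \<open>Relations of cut-free steps\<close>

lemma G_proj:
  assumes "typed \<L> f (sel i A B) C"
  shows "G (f \<cdot> proj i A B) = {(x + sel i 0 (letter_count A), y) |x y. (x, y) \<in> G f}"
  using assms G_comp_K1[of \<L> f A C B] G_comp_K2[of \<L> f B C A]
  by (cases i) (simp_all add: proj_def del: G.simps)

lemma G_incl:
  assumes "typed \<L> f C (sel i A B)"
  shows "G (incl i A B \<cdot> f) = {(x, y + sel i 0 (letter_count A)) |x y. (x, y) \<in> G f}"
proof -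
  have "typed \<L> (dual f) (sel i (dual_fm A) (dual_fm B)) (dual_fm C)"
    using typed_dual[OF assms] by simp
  from G_proj[OF this] have "(G (incl i A B \<cdot> f))\<inverse> = {(x + sel i 0 (letter_count A), y) |x y. (y, x) \<in> G f}"
    by (simp add: G_dual flip: G_dual[of "_ \<cdot> _"] del: G.simps)
  then have "G (incl i A B \<cdot> f) = {(x + sel i 0 (letter_count A), y) |x y. (y, x) \<in> G f}\<inverse>"
    by (metis converse_converse)
  then show ?thesis by auto
qed

lemma G_pair:
  assumes "typed \<L> f C A" and "typed \<L> g C B"
  shows "G (pair f g) = G f \<union> {(x, y + letter_count A) |x y. (x, y) \<in> G g}"
  unfolding pair_eq[OF assms(1)] by (rule G_comp_W[OF assms])

text \<open>A nonempty relation thus reveals which projection was used: its rows lie in the block of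
  letters of factor \<open>i\<close>.\<close>

lemma G_proj_rows:
  assumes "typed \<L> f (sel i A B) C"
  shows "\<forall>(x, y) \<in> G (f \<cdot> proj i A B). x < letter_count A \<longleftrightarrow> i"
  unfolding G_proj[OF assms] using G_bound[OF assms] by (cases i) auto

lemma G_incl_cols:
  assumes "typed \<L> f C (sel i A B)"
  shows "\<forall>(x, y) \<in> G (incl i A B \<cdot> f). y < letter_count A \<longleftrightarrow> i"
  unfolding G_incl[OF assms] using G_bound[OF assms] by (cases i) auto

subsection \<open>Arrows with empty relation\<close>

lemma contradiction_dual [simp]: "contradiction \<L> (dual_fm A) \<longleftrightarrow> tautology \<L> A"
  unfolding contradiction_def tautology_def
  by (metis dual_fm.simps(2,3) dual_fm_dual_fm typed_dual)

lemma tautology_dual [simp]: "tautology \<L> (dual_fm A) \<longleftrightarrow> contradiction \<L> A"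
  by (metis contradiction_dual dual_fm_dual_fm)

text \<open>A cut-free arrow from a product to \<open>FO\<close> can only begin with a projection,
  so one factor already maps to \<open>FO\<close>.\<close>

lemma contradiction_Times:
  assumes "A \<in> formulae \<L>" and "B \<in> formulae \<L>"
  shows "contradiction \<L> (A \<^bold>\<times> B) \<longleftrightarrow> contradiction \<L> A \<or> contradiction \<L> B"
proof
  assume "contradiction \<L> (A \<^bold>\<times> B)"
  then obtain c where "nf \<L> (A \<^bold>\<times> B) FO c" unfolding contradiction_def using typed_nf by blast
  then show "contradiction \<L> A \<or> contradiction \<L> B"
  proof (induction "A \<^bold>\<times> B" "FO :: 'a fm" c rule: nf.induct)
    case (nf_proj i f)
    then show ?case by (cases i) (auto simp: contradiction_def dest: nf_typed)
  qed auto
next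
  assume "contradiction \<L> A \<or> contradiction \<L> B"
  then show "contradiction \<L> (A \<^bold>\<times> B)"
    unfolding contradiction_def using typed_Comp typed_K1[OF assms] typed_K2[OF assms] by metis
qed

lemma tautology_Times:
  assumes "tautology \<L> A" and "tautology \<L> B"
  shows "tautology \<L> (A \<^bold>\<times> B)"
  using assms unfolding tautology_def by (blast intro: typed_pair)

text \<open>Both sides equal \<open>t \<cdot> LT FI \<cdot> c\<close>, by initiality of
  \<open>FO\<close> on the left and terminality of \<open>FI\<close> on the right.\<close>

lemma LT_KT:
  assumes c: "typed \<L> c A FO" and t: "typed \<L> t FI B"
  shows "eqD \<L> A B (LT B \<cdot> c) (t \<cdot> KT A)"
proof -
  have fm: "B \<in> formulae \<L>" "FI \<in> formulae \<L>" using typed_formulae[OF t] by auto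
  have "eqD \<L> A B (LT B \<cdot> c) ((t \<cdot> LT FI) \<cdot> c)"
    by (rule cong_pre[OF eqD_sym[OF L_unique[OF typed_Comp[OF typed_L[OF fm(2)] t]]] c])
  also have "eqD \<L> A B \<dots> (t \<cdot> (LT FI \<cdot> c))"
    by (rule eqD_sym[OF cat_assoc[OF c typed_L[OF fm(2)] t]])
  also have "eqD \<L> A B \<dots> (t \<cdot> KT A)"
    by (rule cong_post[OF K_unique[OF typed_Comp[OF c typed_L[OF fm(2)]]] t])
  finally show ?thesis .
qed

text \<open>The invariant for empty relations: \<open>f\<close> equals every arrow of its type that
  passes through \<open>FO\<close> or \<open>FI\<close> in the indicated way. The first conjunct
  provides at least one such arrow, so two zero-like arrows of the same type must agree.\<close>

definition zero_like :: "'l set \<Rightarrow> 'l fm \<Rightarrow> 'l fm \<Rightarrow> 'l tm \<Rightarrow> bool" where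
  "zero_like \<L> A B f \<longleftrightarrow> (contradiction \<L> A \<or> tautology \<L> B) \<and>
    (\<forall>c. typed \<L> c A FO \<longrightarrow> eqD \<L> A B f (LT B \<cdot> c)) \<and>
    (\<forall>t. typed \<L> t FI B \<longrightarrow> eqD \<L> A B f (t \<cdot> KT A))"

lemma zero_like_dual:
  assumes "zero_like \<L> A B f"
  shows "zero_like \<L> (dual_fm B) (dual_fm A) (dual f)"
  unfolding zero_like_def
proof (intro conjI allI impI)
  show "contradiction \<L> (dual_fm B) \<or> tautology \<L> (dual_fm A)"
    using assms by (auto simp: zero_like_def)
next
  fix c assume "typed \<L> c (dual_fm B) FO"
  from typed_dual[OF this] have "eqD \<L> A B f (dual c \<cdot> KT A)"
    using assms by (simp add: zero_like_def)
  from eqD_dual[OF this] show "eqD \<L> (dual_fm B) (dual_fm A) (dual f) (LT (dual_fm A) \<cdot> c)" by simp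
next
  fix t assume "typed \<L> t FI (dual_fm A)"
  from typed_dual[OF this] have "eqD \<L> A B f (LT B \<cdot> dual t)"
    using assms by (simp add: zero_like_def)
  from eqD_dual[OF this] show "eqD \<L> (dual_fm B) (dual_fm A) (dual f) (t \<cdot> KT (dual_fm B))" by simp
qed

lemma zero_like_dualI: "zero_like \<L> (dual_fm B) (dual_fm A) (dual f) \<Longrightarrow> zero_like \<L> A B f"
  using zero_like_dual by fastforce

lemma zero_like_eqD: "zero_like \<L> A B f \<Longrightarrow> eqD \<L> A B f g \<Longrightarrow> zero_like \<L> A B g"
  unfolding zero_like_def by (blast intro: eqD_sym eqD_trans)

lemma zero_like_KT: "A \<in> formulae \<L> \<Longrightarrow> zero_like \<L> A FI (KT A)"
  unfolding zero_like_def tautology_def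
  by (auto intro!: typed_Id formulae.intros eqD_sym[OF K_unique] intro: typed.intros)

lemma zero_like_proj:
  assumes A: "A \<in> formulae \<L>" and B: "B \<in> formulae \<L>"
    and f: "typed \<L> f (sel i A B) C" and z: "zero_like \<L> (sel i A B) C f"
  shows "zero_like \<L> (A \<^bold>\<times> B) C (f \<cdot> proj i A B)"
proof -
  let ?S = "sel i A B" and ?P = "A \<^bold>\<times> B"
  have C: "C \<in> formulae \<L>" and S: "?S \<in> formulae \<L>" using typed_formulae[OF f] by auto
  note p = typed_proj[OF A B, of i]
  have t: "eqD \<L> ?P C (f \<cdot> proj i A B) (t \<cdot> KT ?P)" if t: "typed \<L> t FI C" for t
  proof -
    have "eqD \<L> ?P C (f \<cdot> proj i A B) ((t \<cdot> KT ?S) \<cdot> proj i A B)"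
      using z t by (intro cong_pre[OF _ p]) (simp add: zero_like_def)
    also have "eqD \<L> ?P C \<dots> (t \<cdot> (KT ?S \<cdot> proj i A B))"
      by (rule eqD_sym[OF cat_assoc[OF p typed_K[OF S] t]])
    also have "eqD \<L> ?P C \<dots> (t \<cdot> KT ?P)"
      by (rule cong_post[OF K_unique[OF typed_Comp[OF p typed_K[OF S]]] t])
    finally show ?thesis .
  qed
  have c: "eqD \<L> ?P C (f \<cdot> proj i A B) (LT C \<cdot> c)" if c: "typed \<L> c ?P FO" for c
  \<comment> \<open>An arrow \<open>c\<close> from the product to \<open>FO\<close> need not come
    from factor \<open>i\<close>. If \<open>C\<close> is a tautology, \<open>LT_KT\<close> trades
    \<open>c\<close> for a passage through \<open>FI\<close>; otherwise factor \<open>i\<close> is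
    itself a contradiction, and any two arrows into \<open>FO\<close> agree.\<close>
  proof (cases "tautology \<L> C")
    case True
    then obtain u where "typed \<L> u FI C" by (auto simp: tautology_def)
    then show ?thesis by (metis t LT_KT[OF c] eqD_sym eqD_trans)
  next
    case False
    then obtain d where d: "typed \<L> d ?S FO" using z by (auto simp: zero_like_def contradiction_def)
    have "eqD \<L> ?P C (f \<cdot> proj i A B) ((LT C \<cdot> d) \<cdot> proj i A B)"
      using z d by (intro cong_pre[OF _ p]) (simp add: zero_like_def)
    also have "eqD \<L> ?P C \<dots> (LT C \<cdot> (d \<cdot> proj i A B))"
      by (rule eqD_sym[OF cat_assoc[OF p d typed_L[OF C]]])
    also have "eqD \<L> ?P C \<dots> (LT C \<cdot> c)"
      by (rule cong_post[OF to_FO_unique[OF typed_Comp[OF p d] c] typed_L[OF C]])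
    finally show ?thesis .
  qed
  have "contradiction \<L> ?P \<or> tautology \<L> C"
    using z by (cases i) (auto simp: zero_like_def contradiction_Times[OF A B])
  with t c show ?thesis unfolding zero_like_def by blast
qed

lemma zero_like_pair:
  assumes f: "typed \<L> f C A" "zero_like \<L> C A f" and g: "typed \<L> g C B" "zero_like \<L> C B g"
  shows "zero_like \<L> C (A \<^bold>\<times> B) (pair f g)"
proof -
  let ?P = "A \<^bold>\<times> B"
  have fm: "A \<in> formulae \<L>" "B \<in> formulae \<L>" "C \<in> formulae \<L>"
    using typed_formulae f g by auto
  \<comment> \<open>A composite into a product is determined by its two components; this serves both
    kinds of passage, with \<open>u\<close> being \<open>LT\<close> or \<open>t\<close>.\<close>
  have *: "eqD \<L> C ?P (pair f g) (u \<cdot> v)"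
    if u: "typed \<L> u D ?P" and v: "typed \<L> v C D"
      and fu: "eqD \<L> C A f ((K1 A B \<cdot> u) \<cdot> v)" and gu: "eqD \<L> C B g ((K2 A B \<cdot> u) \<cdot> v)" for u v D
  proof -
    have "eqD \<L> C ?P (pair f g) (pair ((K1 A B \<cdot> u) \<cdot> v) ((K2 A B \<cdot> u) \<cdot> v))"
      by (rule cong_pair[OF fu gu])
    also have "eqD \<L> C ?P \<dots> (pair (K1 A B \<cdot> u) (K2 A B \<cdot> u) \<cdot> v)"
      using fm by (intro eqD_sym[OF pair_comp[OF v]] typed_Comp[OF u] typed_K1 typed_K2)
    also have "eqD \<L> C ?P \<dots> (u \<cdot> v)"
      by (rule cong_pre[OF eqD_sym[OF pair_eta[OF u]] v])
    finally show ?thesis .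
  qed
  show ?thesis unfolding zero_like_def
  proof (intro conjI allI impI)
    show "contradiction \<L> C \<or> tautology \<L> ?P"
      using f g tautology_Times by (auto simp: zero_like_def)
  next
    fix c assume c: "typed \<L> c C FO"
    have L: "typed \<L> (LT ?P) FO ?P" using fm by (simp add: typed_L Times_formulae)
    have "eqD \<L> C A f ((K1 A B \<cdot> LT ?P) \<cdot> c)"
      using f(2) c cong_pre[OF L_unique[OF typed_Comp[OF L typed_K1[OF fm(1,2)]]] c]
      by (simp add: zero_like_def) (blast intro: eqD_sym eqD_trans)
    moreover have "eqD \<L> C B g ((K2 A B \<cdot> LT ?P) \<cdot> c)"
      using g(2) c cong_pre[OF L_unique[OF typed_Comp[OF L typed_K2[OF fm(1,2)]]] c]
      by (simp add: zero_like_def) (blast intro: eqD_sym eqD_trans)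
    ultimately show "eqD \<L> C ?P (pair f g) (LT ?P \<cdot> c)" by (rule *[OF L c])
  next
    fix t assume t: "typed \<L> t FI ?P"
    show "eqD \<L> C ?P (pair f g) (t \<cdot> KT C)"
      using f(2) g(2) typed_Comp[OF t typed_K1[OF fm(1,2)]] typed_Comp[OF t typed_K2[OF fm(1,2)]]
      by (intro *[OF t typed_K[OF fm(3)]]) (auto simp: zero_like_def)
  qed
qed

text \<open>Every immediate subterm of a cut-free term contributes a shifted copy of its relation,
  so emptiness is inherited downwards. The identity of a letter is excluded because its relation is
  nonempty.\<close>

lemma zero_like:
  assumes "typed \<L> f A B" and "G f = {}"
  shows "zero_like \<L> A B f"
  using typed_nf[OF assms(1)] assms(2)
proof (induction rule: nf.induct)
  case (nf_K A)
  show ?case by (rule zero_like_KT[OF nf_K.hyps])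
next
  case (nf_L A)
  show ?case
    using zero_like_KT[OF dual_fm_formulae[OF nf_L.hyps]] by - (rule zero_like_dualI, simp)
next
  case (nf_proj A B i C f)
  have f: "typed \<L> f (sel i A B) C" by (rule nf_typed[OF nf_proj.hyps(3)])
  have "G f = {}" using nf_proj.prems unfolding G_proj[OF f] by auto
  then show ?case by (rule zero_like_proj[OF nf_proj.hyps(1,2) f nf_proj.IH])
next
  case (nf_incl A B C i f)
  have f: "typed \<L> f C (sel i A B)" by (rule nf_typed[OF nf_incl.hyps(3)])
  then have "typed \<L> (dual f) (sel i (dual_fm A) (dual_fm B)) (dual_fm C)"
    using typed_dual by fastforce
  moreover have "G f = {}" using nf_incl.prems unfolding G_incl[OF f] by auto
  then have "zero_like \<L> C (sel i A B) f" by (rule nf_incl.IH)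
  from zero_like_dual[OF this]
  have "zero_like \<L> (sel i (dual_fm A) (dual_fm B)) (dual_fm C) (dual f)" by simp
  ultimately show ?case
    using nf_incl.hyps by - (rule zero_like_dualI, simp add: zero_like_proj dual_fm_formulae)
next
  case (nf_pair C A f B g)
  have ty: "typed \<L> f C A" "typed \<L> g C B" using nf_pair.hyps nf_typed by auto
  have "G f = {}" "G g = {}" using nf_pair.prems unfolding G_pair[OF ty] by auto
  then show ?case by (simp add: zero_like_pair nf_pair.IH ty)
next
  case (nf_copair A C f B g)
  have ty: "typed \<L> f A C" "typed \<L> g B C" using nf_copair.hyps nf_typed by auto
  have "G (dual (copair f g)) = {}" unfolding G_dual using nf_copair.prems by simp
  then have "G (dual f) = {}" "G (dual g) = {}"
    using G_pair[OF typed_dual[OF ty(1)] typed_dual[OF ty(2)]] by auto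
  then have "zero_like \<L> A C f" "zero_like \<L> B C g" using nf_copair.IH
    by (simp_all only: G_dual) (metis converse_converse converse_empty)+
  then show ?case
    using ty by - (rule zero_like_dualI, simp add: zero_like_pair typed_dual zero_like_dual)
next
  case (nf_eq A B f g)
  then show ?case using G_eqD zero_like_eqD by blast
qed auto

lemma empty_unique:
  assumes "typed \<L> f A B" "G f = {}" and "typed \<L> g A B" "G g = {}"
  shows "eqD \<L> A B f g"
proof -
  have f: "zero_like \<L> A B f" and g: "zero_like \<L> A B g" using zero_like assms by blast+
  from f consider c where "typed \<L> c A FO" | t where "typed \<L> t FI B"
    by (auto simp: zero_like_def contradiction_def tautology_def)
  then show ?thesis
    by cases (use f g in \<open>meson zero_like_def eqD_trans eqD_sym\<close>)+
qed

text \<open>By \<open>empty_unique\<close> any \<open>h\<close> with empty relation will do. It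
  passes through \<open>FO\<close> if factor \<open>i\<close> is a contradiction. Otherwise neither
  factor is, so \<open>zero_like\<close> makes \<open>C\<close> a tautology and \<open>h\<close>
  passes through \<open>FI\<close>.\<close>

lemma factor_proj_empty:
  assumes A: "A \<in> formulae \<L>" and B: "B \<in> formulae \<L>"
    and f: "typed \<L> f (A \<^bold>\<times> B) C" "G f = {}"
    and c: "contradiction \<L> (sel i A B) \<or> \<not> contradiction \<L> (sel (\<not> i) A B)"
  shows "\<exists>h. typed \<L> h (sel i A B) C \<and> eqD \<L> (A \<^bold>\<times> B) C f (h \<cdot> proj i A B)"
proof -
  have C: "C \<in> formulae \<L>" and S: "sel i A B \<in> formulae \<L>"
    using typed_formulae[OF f(1)] A B by (cases i; simp)+
  have "\<exists>h. typed \<L> h (sel i A B) C \<and> G h = {}"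
  proof (cases "contradiction \<L> (sel i A B)")
    case True
    then obtain d where "typed \<L> d (sel i A B) FO" by (auto simp: contradiction_def)
    then have "typed \<L> (LT C \<cdot> d) (sel i A B) C" "G (LT C \<cdot> d) = {}"
      using typed_L[OF C] by (auto intro: typed_Comp)
    then show ?thesis by blast
  next
    case False
    with c have "\<not> contradiction \<L> (A \<^bold>\<times> B)" by (cases i) (auto simp: contradiction_Times[OF A B])
    with zero_like[OF f] obtain t where "typed \<L> t FI C" by (auto simp: zero_like_def tautology_def)
    then have "typed \<L> (t \<cdot> KT (sel i A B)) (sel i A B) C" "G (t \<cdot> KT (sel i A B)) = {}"
      using typed_K[OF S] by (auto intro: typed_Comp)
    then show ?thesis by blast
  qed
  then obtain h where h: "typed \<L> h (sel i A B) C" "G h = {}" by blast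
  then have "eqD \<L> (A \<^bold>\<times> B) C f (h \<cdot> proj i A B)"
    using typed_Comp[OF typed_proj[OF A B] h(1)] by (intro empty_unique f) auto
  with h show ?thesis by blast
qed

subsection \<open>Factoring through projections and injections\<close>

lemma plus_occurs_simps [simp]:
  "\<not> plus_occurs (Letter p)" "\<not> plus_occurs FI" "\<not> plus_occurs FO"
  "plus_occurs (A \<^bold>\<times> B) \<longleftrightarrow> plus_occurs A \<or> plus_occurs B" "plus_occurs (A \<^bold>+ B)"
  by (auto simp: plus_occurs_def)

lemma times_occurs_simps [simp]:
  "\<not> times_occurs (Letter p)" "\<not> times_occurs FI" "\<not> times_occurs FO"
  "times_occurs (A \<^bold>\<times> B)" "times_occurs (A \<^bold>+ B) \<longleftrightarrow> times_occurs A \<or> times_occurs B"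
  by (auto simp: times_occurs_def)

lemma times_occurs_dual [simp]: "times_occurs (dual_fm A) \<longleftrightarrow> plus_occurs A"
  by (induction A) auto

text \<open>Copairing never occurs, as the source is a product. Pairing is the delicate step: one
  component may be empty although the whole relation is not, and may exist only because the
  discarded factor is a contradiction. The first two alternatives of the last hypothesis let empty
  arrows factor; the third excludes pairing and keeps the relation nonempty.\<close>

lemma factor_proj:
  assumes A: "A \<in> formulae \<L>" and B: "B \<in> formulae \<L>"
    and "typed \<L> f (A \<^bold>\<times> B) C"
    and "\<forall>(x, y) \<in> G f. x < letter_count A \<longleftrightarrow> i"
    and "contradiction \<L> (sel i A B) \<or> \<not> contradiction \<L> (sel (\<not> i) A B) \<or>
      \<not> times_occurs C \<and> G f \<noteq> {}"
  shows "\<exists>h. typed \<L> h (sel i A B) C \<and> eqD \<L> (A \<^bold>\<times> B) C f (h \<cdot> proj i A B)"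
  using typed_nf[OF assms(3)] assms(4,5)
proof (induction "A \<^bold>\<times> B" C f rule: nf.induct)
  case nf_K
  have "sel i A B \<in> formulae \<L>" using A B by (cases i) auto
  then have "typed \<L> (KT (sel i A B)) (sel i A B) FI" by (rule typed_K)
  then show ?case using K_unique typed_Comp[OF typed_proj[OF A B]] eqD_sym by blast
next
  case (nf_proj j C f)
  have f: "typed \<L> f (sel j A B) C" by (rule nf_typed[OF nf_proj.hyps(3)])
  show ?case
  proof (cases "j = i")
    case True
    with f show ?thesis using eqD_refl typed_Comp[OF typed_proj[OF A B]] by blast
  next
    case False
    \<comment> \<open>By hypothesis all rows lie in factor \<open>i\<close>, by construction in the
      other one; so there are none, and the alternative demanding nonemptiness fails.\<close>
    have "G (f \<cdot> proj j A B) = {}"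
      using False nf_proj.prems(1) G_proj_rows[OF f] by fast
    then show ?thesis
      using nf_proj.prems(2) typed_Comp[OF typed_proj[OF A B] f] by (intro factor_proj_empty A B) auto
  qed
next
  case (nf_incl C D j f)
  have f: "typed \<L> f (A \<^bold>\<times> B) (sel j C D)" by (rule nf_typed[OF nf_incl.hyps(3)])
  have "\<exists>h. typed \<L> h (sel i A B) (sel j C D) \<and> eqD \<L> (A \<^bold>\<times> B) (sel j C D) f (h \<cdot> proj i A B)"
  proof (rule nf_incl.hyps(4))
    show "\<forall>(x, y) \<in> G f. x < letter_count A \<longleftrightarrow> i"
      using nf_incl.prems(1) unfolding G_incl[OF f] by blast
    have "times_occurs (sel j C D) \<Longrightarrow> times_occurs (C \<^bold>+ D)" by (cases j) auto
    moreover have "G f = {} \<Longrightarrow> G (incl j C D \<cdot> f) = {}" by simp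
    ultimately show "contradiction \<L> (sel i A B) \<or> \<not> contradiction \<L> (sel (\<not> i) A B) \<or>
      \<not> times_occurs (sel j C D) \<and> G f \<noteq> {}"
      using nf_incl.prems(2) by blast
  qed
  then obtain h where h: "typed \<L> h (sel i A B) (sel j C D)"
    "eqD \<L> (A \<^bold>\<times> B) (sel j C D) f (h \<cdot> proj i A B)" by blast
  note j = typed_incl[OF nf_incl.hyps(1,2), of j]
  have "eqD \<L> (A \<^bold>\<times> B) (C \<^bold>+ D) (incl j C D \<cdot> f) ((incl j C D \<cdot> h) \<cdot> proj i A B)"
    by (rule eqD_trans[OF cong_post[OF h(2) j] cat_assoc[OF typed_proj[OF A B] h(1) j]])
  with typed_Comp[OF h(1) j] show ?case by blast
next
  case (nf_pair C f D g)
  have ty: "typed \<L> f (A \<^bold>\<times> B) C" "typed \<L> g (A \<^bold>\<times> B) D" using nf_pair.hyps nf_typed by auto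
  have "\<forall>(x, y) \<in> G f. x < letter_count A \<longleftrightarrow> i" "\<forall>(x, y) \<in> G g. x < letter_count A \<longleftrightarrow> i"
    using nf_pair.prems(1) unfolding G_pair[OF ty] by blast+
  \<comment> \<open>The target is a product, so the third alternative fails; what remains does not
    mention the target and passes to both components.\<close>
  moreover have "contradiction \<L> (sel i A B) \<or> \<not> contradiction \<L> (sel (\<not> i) A B)"
    using nf_pair.prems(2) by simp
  ultimately obtain h k where h: "typed \<L> h (sel i A B) C" "eqD \<L> (A \<^bold>\<times> B) C f (h \<cdot> proj i A B)"
    and k: "typed \<L> k (sel i A B) D" "eqD \<L> (A \<^bold>\<times> B) D g (k \<cdot> proj i A B)"
    using nf_pair.hyps by blast
  have "eqD \<L> (A \<^bold>\<times> B) (C \<^bold>\<times> D) (pair f g) (pair h k \<cdot> proj i A B)"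
    by (rule eqD_trans[OF cong_pair[OF h(2) k(2)]
      eqD_sym[OF pair_comp[OF typed_proj[OF A B] h(1) k(1)]]])
  with typed_pair[OF h(1) k(1)] show ?case by blast
next
  case (nf_eq C f g)
  then show ?case using G_eqD[OF nf_eq.hyps(3)] by (metis eqD_sym eqD_trans)
qed

text \<open>Dual of \<open>factor_proj\<close>: rows become columns, and absence of products in the
  target becomes absence of sums in the source.\<close>

lemma factor_incl:
  assumes A: "A \<in> formulae \<L>" and B: "B \<in> formulae \<L>"
    and f: "typed \<L> f C (A \<^bold>+ B)"
    and cols: "\<forall>(x, y) \<in> G f. y < letter_count A \<longleftrightarrow> i"
    and "tautology \<L> (sel i A B) \<or> \<not> tautology \<L> (sel (\<not> i) A B) \<or>
      \<not> plus_occurs C \<and> G f \<noteq> {}"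
  shows "\<exists>h. typed \<L> h C (sel i A B) \<and> eqD \<L> C (A \<^bold>+ B) f (incl i A B \<cdot> h)"
proof -
  have "\<exists>h. typed \<L> h (sel i (dual_fm A) (dual_fm B)) (dual_fm C) \<and>
    eqD \<L> (dual_fm A \<^bold>\<times> dual_fm B) (dual_fm C) (dual f) (h \<cdot> proj i (dual_fm A) (dual_fm B))"
    using assms typed_dual[OF f]
    by (intro factor_proj dual_fm_formulae) (auto simp: G_dual simp flip: dual_fm_sel)
  then obtain h where "typed \<L> h (sel i (dual_fm A) (dual_fm B)) (dual_fm C)"
    "eqD \<L> (dual_fm A \<^bold>\<times> dual_fm B) (dual_fm C) (dual f) (h \<cdot> proj i (dual_fm A) (dual_fm B))"
    by blast
  from this(1)[THEN typed_dual] this(2)[THEN eqD_dual] show ?thesis by auto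
qed

section \<open>Comparing the last steps of two cut-free terms\<close>

lemma G_proj_inject:
  assumes "typed \<L> f (sel i A B) C" and "typed \<L> g (sel i A B) C"
    and "G (f \<cdot> proj i A B) = G (g \<cdot> proj i A B)"
  shows "G f = G g"
proof -
  have "(x, y) \<in> G h \<longleftrightarrow> (x + sel i 0 (letter_count A), y) \<in> G (h \<cdot> proj i A B)"
    if "typed \<L> h (sel i A B) C" for x y h
    unfolding G_proj[OF that] by auto
  from this[OF assms(1)] this[OF assms(2)] assms(3) show ?thesis by auto
qed

lemma G_incl_inject:
  assumes "typed \<L> f C (sel i A B)" and "typed \<L> g C (sel i A B)"
    and "G (incl i A B \<cdot> f) = G (incl i A B \<cdot> g)"
  shows "G f = G g"
proof -
  have "(x, y) \<in> G h \<longleftrightarrow> (x, y + sel i 0 (letter_count A)) \<in> G (incl i A B \<cdot> h)"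
    if "typed \<L> h C (sel i A B)" for x y h
    unfolding G_incl[OF that] by auto
  from this[OF assms(1)] this[OF assms(2)] assms(3) show ?thesis by auto
qed

text \<open>Nonemptiness excludes \<open>KT\<close> and \<open>LT\<close>. Pairing and copairing are
  recorded only through the shape of the type, because \<open>pair_eta\<close> and
  \<open>copair_eta\<close> decompose any arrow of that type.\<close>

lemma nf_nonempty_cases:
  assumes "nf \<L> A B f" and "G f \<noteq> {}"
  obtains (Plus) A\<^sub>1 A\<^sub>2 where "A = A\<^sub>1 \<^bold>+ A\<^sub>2"
  | (Times) B\<^sub>1 B\<^sub>2 where "B = B\<^sub>1 \<^bold>\<times> B\<^sub>2"
  | (Id) p where "A = Letter p" "B = Letter p" "eqD \<L> A B f (IdT A)"
  | (proj) A\<^sub>1 A\<^sub>2 i g where "A = A\<^sub>1 \<^bold>\<times> A\<^sub>2" "typed \<L> g (sel i A\<^sub>1 A\<^sub>2) B"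
      "eqD \<L> A B f (g \<cdot> proj i A\<^sub>1 A\<^sub>2)"
  | (incl) B\<^sub>1 B\<^sub>2 i g where "B = B\<^sub>1 \<^bold>+ B\<^sub>2" "typed \<L> g A (sel i B\<^sub>1 B\<^sub>2)"
      "eqD \<L> A B f (incl i B\<^sub>1 B\<^sub>2 \<cdot> g)"
  using assms
proof (induction arbitrary: thesis rule: nf.induct)
  case (nf_Id p)
  then show ?case by (metis eqD_refl typed_Id formulae.intros(1))
next
  case (nf_proj A B i C f)
  then show ?case by (metis eqD_refl nf_typed nf.nf_proj)
next
  case (nf_incl A B C i f)
  then show ?case by (metis eqD_refl nf_typed nf.nf_incl)
next
  case (nf_eq A B f g)
  have "G f \<noteq> {}" using nf_eq.prems(6) G_eqD[OF nf_eq.hyps(2)] by simp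
  show ?case
    by (rule nf_eq.IH[OF _ _ _ _ _ \<open>G f \<noteq> {}\<close>])
      (use nf_eq.prems(1-5) eqD_sym[OF nf_eq.hyps(2)] eqD_trans in metis)+
qed auto

lemma O_normal_Times: "O_normal \<L> (A \<^bold>\<times> B) \<Longrightarrow> O_normal \<L> (sel i A B)"
  and O_normal_Plus: "O_normal \<L> (A \<^bold>+ B) \<Longrightarrow> O_normal \<L> (sel i A B)"
  and I_normal_Times: "I_normal \<L> (A \<^bold>\<times> B) \<Longrightarrow> I_normal \<L> (sel i A B)"
  and I_normal_Plus: "I_normal \<L> (A \<^bold>+ B) \<Longrightarrow> I_normal \<L> (sel i A B)"
  by (cases i; simp add: O_normal_def I_normal_def; blast)+

lemma O_normal_not_plus:
  "O_normal \<L> (A \<^bold>\<times> B) \<Longrightarrow> contradiction \<L> (sel (\<not> i) A B) \<Longrightarrow> \<not> plus_occurs (sel i A B)"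
  by (cases i) (auto simp: O_normal_def)

lemma I_normal_not_times:
  "I_normal \<L> (A \<^bold>+ B) \<Longrightarrow> tautology \<L> (sel (\<not> i) A B) \<Longrightarrow> \<not> times_occurs (sel i A B)"
  by (cases i) (auto simp: I_normal_def)

text \<open>The critical pair of last steps. Sharing a relation confines the rows of
  \<open>g\<close> to factor \<open>i\<close> and the columns of \<open>f\<close> to summand
  \<open>j\<close>, so either term is a candidate for factoring once more.\<close>

lemma proj_incl_common_factor:
  assumes A: "A\<^sub>1 \<in> formulae \<L>" "A\<^sub>2 \<in> formulae \<L>" and B: "B\<^sub>1 \<in> formulae \<L>" "B\<^sub>2 \<in> formulae \<L>"
    and f: "typed \<L> f (sel i A\<^sub>1 A\<^sub>2) (B\<^sub>1 \<^bold>+ B\<^sub>2)" and g: "typed \<L> g (A\<^sub>1 \<^bold>\<times> A\<^sub>2) (sel j B\<^sub>1 B\<^sub>2)"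
    and eq: "G (f \<cdot> proj i A\<^sub>1 A\<^sub>2) = G (incl j B\<^sub>1 B\<^sub>2 \<cdot> g)" and ne: "G (f \<cdot> proj i A\<^sub>1 A\<^sub>2) \<noteq> {}"
    and normal: "O_normal \<L> (A\<^sub>1 \<^bold>\<times> A\<^sub>2) \<or> I_normal \<L> (B\<^sub>1 \<^bold>+ B\<^sub>2)"
  obtains h where "typed \<L> h (sel i A\<^sub>1 A\<^sub>2) (sel j B\<^sub>1 B\<^sub>2)"
      "eqD \<L> (sel i A\<^sub>1 A\<^sub>2) (B\<^sub>1 \<^bold>+ B\<^sub>2) f (incl j B\<^sub>1 B\<^sub>2 \<cdot> h)"
    | h where "typed \<L> h (sel i A\<^sub>1 A\<^sub>2) (sel j B\<^sub>1 B\<^sub>2)"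
      "eqD \<L> (A\<^sub>1 \<^bold>\<times> A\<^sub>2) (sel j B\<^sub>1 B\<^sub>2) g (h \<cdot> proj i A\<^sub>1 A\<^sub>2)"
proof -
  have rows: "\<forall>(x, y) \<in> G g. x < letter_count A\<^sub>1 \<longleftrightarrow> i"
    using G_proj_rows[OF f] unfolding eq G_incl[OF g] by blast
  have cols: "\<forall>(x, y) \<in> G f. y < letter_count B\<^sub>1 \<longleftrightarrow> j"
    using G_incl_cols[OF g] unfolding eq[symmetric] G_proj[OF f] by blast
  have nf: "G f \<noteq> {}" using ne by auto
  have ng: "G g \<noteq> {}" using ne unfolding eq by auto
  \<comment> \<open>Under O-normality, a contradictory discarded factor forbids sums in the kept
    one, which is the condition \<open>factor_incl\<close> puts on the source of \<open>f\<close>.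
    I-normality gives the mirror image, for \<open>factor_proj\<close> and the target of
    \<open>g\<close>.\<close>
  consider "\<not> contradiction \<L> (sel (\<not> i) A\<^sub>1 A\<^sub>2) \<or> \<not> times_occurs (sel j B\<^sub>1 B\<^sub>2)"
    | "\<not> tautology \<L> (sel (\<not> j) B\<^sub>1 B\<^sub>2) \<or> \<not> plus_occurs (sel i A\<^sub>1 A\<^sub>2)"
    using normal O_normal_not_plus I_normal_not_times by blast
  then show ?thesis
  proof cases
    case 1
    then show ?thesis using factor_proj[OF A g rows] ng that(2) by blast
  next
    case 2
    then show ?thesis using factor_incl[OF B f cols] nf that(1) by blast
  qed
qed

subsection \<open>Coherence\<close>

theorem mainTheorem3:
  fixes \<L> :: "'l set" and f g :: "'l tm" and A B :: "'l fm"
  assumes "typed \<L> f A B" and "typed \<L> g A B"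
    and "G f = G g"
    and "O_normal \<L> A \<or> I_normal \<L> B"
  shows "eqD \<L> A B f g"
  using assms
\<comment> \<open>The sum of the sizes decreases whichever end is decomposed, and normality of
  either end is inherited by its immediate subformulae.\<close>
proof (induction "size A + size B" arbitrary: A B f g rule: less_induct)
  case less
  note f = less.prems(1) and g = less.prems(2) and eq = less.prems(3) and normal = less.prems(4)
  have A: "A \<in> formulae \<L>" and B: "B \<in> formulae \<L>" using typed_formulae[OF f] by auto
  have same_proj: "eqD \<L> A B (h \<cdot> proj i A\<^sub>1 A\<^sub>2) (k \<cdot> proj i A\<^sub>1 A\<^sub>2)"
    if eqA: "A = A\<^sub>1 \<^bold>\<times> A\<^sub>2" and h: "typed \<L> h (sel i A\<^sub>1 A\<^sub>2) B" and k: "typed \<L> k (sel i A\<^sub>1 A\<^sub>2) B"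
      and G: "G (h \<cdot> proj i A\<^sub>1 A\<^sub>2) = G (k \<cdot> proj i A\<^sub>1 A\<^sub>2)" for h k i A\<^sub>1 A\<^sub>2
  proof -
    have p: "typed \<L> (proj i A\<^sub>1 A\<^sub>2) A (sel i A\<^sub>1 A\<^sub>2)" using A by (simp add: eqA Times_formulae typed_proj)
    have "eqD \<L> (sel i A\<^sub>1 A\<^sub>2) B h k"
    proof (rule less.hyps[OF _ h k G_proj_inject[OF h k G]])
      show "size (sel i A\<^sub>1 A\<^sub>2) + size B < size A + size B" by (cases i) (auto simp: eqA)
      show "O_normal \<L> (sel i A\<^sub>1 A\<^sub>2) \<or> I_normal \<L> B" using normal O_normal_Times by (auto simp: eqA)
    qed
    then show ?thesis by (rule cong_pre[OF _ p])
  qed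
  have same_incl: "eqD \<L> A B (incl i B\<^sub>1 B\<^sub>2 \<cdot> h) (incl i B\<^sub>1 B\<^sub>2 \<cdot> k)"
    if eqB: "B = B\<^sub>1 \<^bold>+ B\<^sub>2" and h: "typed \<L> h A (sel i B\<^sub>1 B\<^sub>2)" and k: "typed \<L> k A (sel i B\<^sub>1 B\<^sub>2)"
      and G: "G (incl i B\<^sub>1 B\<^sub>2 \<cdot> h) = G (incl i B\<^sub>1 B\<^sub>2 \<cdot> k)" for h k i B\<^sub>1 B\<^sub>2
  proof -
    have p: "typed \<L> (incl i B\<^sub>1 B\<^sub>2) (sel i B\<^sub>1 B\<^sub>2) B" using B by (simp add: eqB Plus_formulae typed_incl)
    have "eqD \<L> A (sel i B\<^sub>1 B\<^sub>2) h k"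
    proof (rule less.hyps[OF _ h k G_incl_inject[OF h k G]])
      show "size A + size (sel i B\<^sub>1 B\<^sub>2) < size A + size B" by (cases i) (auto simp: eqB)
      show "O_normal \<L> A \<or> I_normal \<L> (sel i B\<^sub>1 B\<^sub>2)" using normal I_normal_Plus by (auto simp: eqB)
    qed
    then show ?thesis by (rule cong_post[OF _ p])
  qed
  \<comment> \<open>The common factor \<open>u\<close> rewrites one side so that both terms share
    the outer injection or the inner projection, where \<open>same_incl\<close> or
    \<open>same_proj\<close> invokes the induction hypothesis.\<close>
  have mixed: "eqD \<L> A B (h \<cdot> proj i A\<^sub>1 A\<^sub>2) (incl j B\<^sub>1 B\<^sub>2 \<cdot> k)"
    if eqA: "A = A\<^sub>1 \<^bold>\<times> A\<^sub>2" and eqB: "B = B\<^sub>1 \<^bold>+ B\<^sub>2"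
      and h: "typed \<L> h (sel i A\<^sub>1 A\<^sub>2) B" and k: "typed \<L> k A (sel j B\<^sub>1 B\<^sub>2)"
      and G: "G (h \<cdot> proj i A\<^sub>1 A\<^sub>2) = G (incl j B\<^sub>1 B\<^sub>2 \<cdot> k)" and ne: "G (h \<cdot> proj i A\<^sub>1 A\<^sub>2) \<noteq> {}"
    for h k i j A\<^sub>1 A\<^sub>2 B\<^sub>1 B\<^sub>2
  proof -
    have fm: "A\<^sub>1 \<in> formulae \<L>" "A\<^sub>2 \<in> formulae \<L>" "B\<^sub>1 \<in> formulae \<L>" "B\<^sub>2 \<in> formulae \<L>"
      using A B by (auto simp: eqA eqB Times_formulae Plus_formulae)
    have p: "typed \<L> (proj i A\<^sub>1 A\<^sub>2) A (sel i A\<^sub>1 A\<^sub>2)" using fm by (simp add: eqA typed_proj)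
    have q: "typed \<L> (incl j B\<^sub>1 B\<^sub>2) (sel j B\<^sub>1 B\<^sub>2) B" using fm by (simp add: eqB typed_incl)
    show ?thesis
    proof (rule proj_incl_common_factor[OF fm h[unfolded eqB] k[unfolded eqA] G ne normal[unfolded eqA eqB]])
      fix u assume u: "typed \<L> u (sel i A\<^sub>1 A\<^sub>2) (sel j B\<^sub>1 B\<^sub>2)"
        and hu: "eqD \<L> (sel i A\<^sub>1 A\<^sub>2) (B\<^sub>1 \<^bold>+ B\<^sub>2) h (incl j B\<^sub>1 B\<^sub>2 \<cdot> u)"
      have "eqD \<L> A B (h \<cdot> proj i A\<^sub>1 A\<^sub>2) ((incl j B\<^sub>1 B\<^sub>2 \<cdot> u) \<cdot> proj i A\<^sub>1 A\<^sub>2)"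
        using hu by (intro cong_pre[OF _ p]) (simp add: eqB)
      also have "eqD \<L> A B \<dots> (incl j B\<^sub>1 B\<^sub>2 \<cdot> (u \<cdot> proj i A\<^sub>1 A\<^sub>2))"
        by (rule eqD_sym[OF cat_assoc[OF p u q]])
      finally have *: "eqD \<L> A B (h \<cdot> proj i A\<^sub>1 A\<^sub>2) (incl j B\<^sub>1 B\<^sub>2 \<cdot> (u \<cdot> proj i A\<^sub>1 A\<^sub>2))" .
      show ?thesis
        using G G_eqD[OF *] by (intro eqD_trans[OF * same_incl[OF eqB typed_Comp[OF p u] k]]) simp
    next
      fix u assume u: "typed \<L> u (sel i A\<^sub>1 A\<^sub>2) (sel j B\<^sub>1 B\<^sub>2)"
        and ku: "eqD \<L> (A\<^sub>1 \<^bold>\<times> A\<^sub>2) (sel j B\<^sub>1 B\<^sub>2) k (u \<cdot> proj i A\<^sub>1 A\<^sub>2)"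
      have "eqD \<L> A B (incl j B\<^sub>1 B\<^sub>2 \<cdot> k) (incl j B\<^sub>1 B\<^sub>2 \<cdot> (u \<cdot> proj i A\<^sub>1 A\<^sub>2))"
        using ku by (intro cong_post[OF _ q]) (simp add: eqA)
      also have "eqD \<L> A B \<dots> ((incl j B\<^sub>1 B\<^sub>2 \<cdot> u) \<cdot> proj i A\<^sub>1 A\<^sub>2)"
        by (rule cat_assoc[OF p u q])
      finally have *: "eqD \<L> A B (incl j B\<^sub>1 B\<^sub>2 \<cdot> k) ((incl j B\<^sub>1 B\<^sub>2 \<cdot> u) \<cdot> proj i A\<^sub>1 A\<^sub>2)" .
      show ?thesis
        using G G_eqD[OF *]
        by (intro eqD_trans[OF same_proj[OF eqA h typed_Comp[OF u q]] eqD_sym[OF *]]) simp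
    qed
  qed
  \<comment> \<open>Different projections use disjoint blocks of rows, so a common nonempty relation
    fixes the index.\<close>
  have disjoint_proj: "i = j"
    if h: "typed \<L> h (sel i A\<^sub>1 A\<^sub>2) B" and k: "typed \<L> k (sel j A\<^sub>1 A\<^sub>2) B"
      and G: "G (h \<cdot> proj i A\<^sub>1 A\<^sub>2) = G (k \<cdot> proj j A\<^sub>1 A\<^sub>2)" and ne: "G (h \<cdot> proj i A\<^sub>1 A\<^sub>2) \<noteq> {}"
    for h k i j A\<^sub>1 A\<^sub>2
    using G_proj_rows[OF h] G_proj_rows[OF k] G ne by fast
  have disjoint_incl: "i = j"
    if h: "typed \<L> h A (sel i B\<^sub>1 B\<^sub>2)" and k: "typed \<L> k A (sel j B\<^sub>1 B\<^sub>2)"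
      and G: "G (incl i B\<^sub>1 B\<^sub>2 \<cdot> h) = G (incl j B\<^sub>1 B\<^sub>2 \<cdot> k)" and ne: "G (incl i B\<^sub>1 B\<^sub>2 \<cdot> h) \<noteq> {}"
    for h k i j B\<^sub>1 B\<^sub>2
    using G_incl_cols[OF h] G_incl_cols[OF k] G ne by fast
  \<comment> \<open>An arrow out of a sum is the copairing of its restrictions, so both terms are
    compared summand by summand, whatever their last steps.\<close>
  have plus_case: "eqD \<L> A B f g" if "A = A\<^sub>1 \<^bold>+ A\<^sub>2" for A\<^sub>1 A\<^sub>2
  proof -
    have "eqD \<L> A\<^sub>1 B (f \<cdot> L1 A\<^sub>1 A\<^sub>2) (g \<cdot> L1 A\<^sub>1 A\<^sub>2)" "eqD \<L> A\<^sub>2 B (f \<cdot> L2 A\<^sub>1 A\<^sub>2) (g \<cdot> L2 A\<^sub>1 A\<^sub>2)"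
      using A f g eq normal O_normal_Plus[of \<L> A\<^sub>1 A\<^sub>2 True] O_normal_Plus[of \<L> A\<^sub>1 A\<^sub>2 False]
      by (intro less.hyps; auto simp: that Plus_formulae intro: typed_Comp typed_L1 typed_L2)+
    from cong_copair[OF this] copair_eta[OF f[unfolded that]] copair_eta[OF g[unfolded that]]
    show ?thesis unfolding that by (blast intro: eqD_trans eqD_sym)
  qed
  have times_case: "eqD \<L> A B f g" if "B = B\<^sub>1 \<^bold>\<times> B\<^sub>2" for B\<^sub>1 B\<^sub>2
  proof -
    have "eqD \<L> A B\<^sub>1 (K1 B\<^sub>1 B\<^sub>2 \<cdot> f) (K1 B\<^sub>1 B\<^sub>2 \<cdot> g)" "eqD \<L> A B\<^sub>2 (K2 B\<^sub>1 B\<^sub>2 \<cdot> f) (K2 B\<^sub>1 B\<^sub>2 \<cdot> g)"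
      using B f g eq normal I_normal_Times[of \<L> B\<^sub>1 B\<^sub>2 True] I_normal_Times[of \<L> B\<^sub>1 B\<^sub>2 False]
      by (intro less.hyps; auto simp: that Times_formulae intro: typed_Comp typed_K1 typed_K2)+
    from cong_pair[OF this] pair_eta[OF f[unfolded that]] pair_eta[OF g[unfolded that]]
    show ?thesis unfolding that by (blast intro: eqD_trans eqD_sym)
  qed
  have via: "eqD \<L> A B f g" if "eqD \<L> A B f f'" "eqD \<L> A B g g'" "eqD \<L> A B f' g'" for f' g'
    using that by (blast intro: eqD_trans eqD_sym)
  show ?case
  proof (cases "G f = {}")
    case True
    with f g eq show ?thesis by (intro empty_unique) auto
  next
    case False
    with eq have g0: "G g \<noteq> {}" by simp
    from typed_nf[OF f] False show ?thesis
    proof (cases rule: nf_nonempty_cases)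
      case (Id p)
      \<comment> \<open>With a letter at both ends, the identity is the only shape left for
        \<open>g\<close>.\<close>
      from typed_nf[OF g] g0 have "eqD \<L> A B g (IdT A)"
        by (cases rule: nf_nonempty_cases) (use Id in auto)
      with Id show ?thesis by (blast intro: eqD_trans eqD_sym)
    next
      case f': (proj A\<^sub>1 A\<^sub>2 i h)
      have Gf: "G (h \<cdot> proj i A\<^sub>1 A\<^sub>2) = G f" using G_eqD[OF f'(3)] by simp
      from typed_nf[OF g] g0 show ?thesis
      proof (cases rule: nf_nonempty_cases)
        case g': (proj A\<^sub>1' A\<^sub>2' j k)
        then have [simp]: "A\<^sub>1' = A\<^sub>1" "A\<^sub>2' = A\<^sub>2" using f'(1) by auto
        have G: "G (h \<cdot> proj i A\<^sub>1 A\<^sub>2) = G (k \<cdot> proj j A\<^sub>1 A\<^sub>2)"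
          using Gf eq G_eqD[OF g'(3)] by simp
        have k: "typed \<L> k (sel j A\<^sub>1 A\<^sub>2) B" using g'(2) by simp
        have "i = j" using disjoint_proj[OF f'(2) k G] Gf False by metis
        with same_proj[OF f'(1,2), of k] k G g'(3) f'(3) show ?thesis by (intro via) simp_all
      next
        case g': (incl B\<^sub>1 B\<^sub>2 j k)
        have G: "G (h \<cdot> proj i A\<^sub>1 A\<^sub>2) = G (incl j B\<^sub>1 B\<^sub>2 \<cdot> k)"
          using Gf eq G_eqD[OF g'(3)] by metis
        show ?thesis
          by (rule via[OF f'(3) g'(3) mixed[OF f'(1) g'(1) f'(2) g'(2) G]]) (use Gf False in metis)
      qed (use f'(1) plus_case times_case in auto)
    next
      case f': (incl B\<^sub>1 B\<^sub>2 i h)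
      have Gf: "G (incl i B\<^sub>1 B\<^sub>2 \<cdot> h) = G f" using G_eqD[OF f'(3)] by simp
      from typed_nf[OF g] g0 show ?thesis
      proof (cases rule: nf_nonempty_cases)
        case g': (incl B\<^sub>1' B\<^sub>2' j k)
        then have [simp]: "B\<^sub>1' = B\<^sub>1" "B\<^sub>2' = B\<^sub>2" using f'(1) by auto
        have G: "G (incl i B\<^sub>1 B\<^sub>2 \<cdot> h) = G (incl j B\<^sub>1 B\<^sub>2 \<cdot> k)"
          using Gf eq G_eqD[OF g'(3)] by simp
        have k: "typed \<L> k A (sel j B\<^sub>1 B\<^sub>2)" using g'(2) by simp
        have "i = j" using disjoint_incl[OF f'(2) k G] Gf False by metis
        with same_incl[OF f'(1,2), of k] k G g'(3) f'(3) show ?thesis by (intro via) simp_all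
      next
        case g': (proj A\<^sub>1 A\<^sub>2 j k)
        have G: "G (k \<cdot> proj j A\<^sub>1 A\<^sub>2) = G (incl i B\<^sub>1 B\<^sub>2 \<cdot> h)"
          using Gf eq G_eqD[OF g'(3)] by metis
        have "G (k \<cdot> proj j A\<^sub>1 A\<^sub>2) \<noteq> {}" using G Gf False by metis
        from mixed[OF g'(1) f'(1) g'(2) f'(2) G this] show ?thesis
          by (rule via[OF f'(3) g'(3) eqD_sym])
      qed (use f'(1) plus_case times_case in auto)
    qed (use plus_case times_case in auto)
  qed
qed

end
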